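(* Let $m=2n$, $r=n$ and let $\mathcal P$ be a labelled link pattern of rank $n$ on $2n$ nodes all of whose arrows have targets at nodes $i\le n$, with associated permutation $w_{\mathcal P}\in\mathfrak S_n$. Then, after the substitution $\mu_i:=\mu_i^{-1}$ and $x_{i+n}:=y_i$ for $1\le i\le n$, the reduced class $\mathcal E\ell\ell^{\rm red}(\mathcal P)$ represents the (localized) torus-equivariant elliptic characteristic class of the Schubert variety $X_{w_{\mathcal P}}$ in $\mathcal F\ell_n=\mathrm{GL}_n/\mathrm B_n$; that is, for every torus-fixed point $\sigma\in\mathfrak S_n$ of $\mathcal F\ell_n$, the substitution $y_i:=x_{\sigma(i)}$ $(1\le i\le n)$ in it gives the restriction $\mathcal E\ell\ell(X_{w_{\mathcal P}})_{|\sigma}$.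
   Context: **Functions and operations.** For $\operatorname{Im}\tau>0$, $q=e^{2\pi i\tau}$, put $\theta_\tau(x)=2q^{1/8}\sin(\pi x)\prod_{k\ge1}(1-q^k)(1-q^ke^{2\pi i x})(1-q^ke^{-2\pi i x})$ and $F_\tau(x,y)=\frac{\theta_\tau'(0)\theta_\tau(x+y)}{\theta_\tau(x)\theta_\tau(y)}$; let $\delta(e^{2\pi i x},e^{2\pi i y})=F_\tau(x,y)$. Write $\vartheta$ for the theta function with argument written multiplicatively, $\vartheta(e^{2\pi i x})=\theta_\tau(x)$, normalized by a constant so that $\delta(a,b)=\frac{\vartheta(ab)}{\vartheta(a)\vartheta(b)}$. For a nontrivial Laurent monomial $\nu$ in $h,\mu_1,\dots,\mu_n$, $\mathfrak C_i^\nu(f)=\delta(\tfrac{x_{i+1}}{x_i},\nu)f+\delta(\tfrac{x_i}{x_{i+1}},h)s_if$, where $s_i$ exchanges $x_i$ and $x_{i+1}$ only. **Types.** Additively, $\theta(\ell)$ for an integral linear combination $\ell$ of variables has type $\tfrac12\ell^2$; types add under products, subtract under quotients, so $\operatorname{type}\delta(\ell_1,\ell_2)=\ell_1\ell_2$. A Laurent polynomial in theta functions is pure if all its summands have the same type. The admissible parameter of $\mathfrak C_i$ applied to a pure $g$ is $\nu=\frac{\operatorname{type}(g)-s_i\operatorname{type}(g)}{x_i-x_{i+1}}-h$ (the one for which $\mathfrak C_i^\nu(g)$ is pure). **Classes of link patterns.** A labelled link pattern of rank $n$ on $2n$ nodes is a sequence $((a_1,b_1),\dots,(a_n,b_n))$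 of pairs (source, target) with all $a_i,b_i\in\{1,\dots,2n\}$ distinct. $w\in\mathfrak S_{2n}$ acts on all $a_i,b_i$; $\sigma\in\mathfrak S_n$ acts by relabelling, $\sigma^\mu$ giving label $\sigma(i)$ to the arrow labelled $i$, and on functions by replacing $\mu_i$ with $\mu_{\sigma(i)}$. The minimal pattern is $\mathcal P^{\min}_{2n,n}=((n+1,1),\dots,(2n,n))$ and $$\mathcal E\ell\ell(\mathcal P^{\min}_{2n,n})=\prod_{i=1}^n\Big(\delta(u\tfrac{x_i}{x_{n+i}},\mu_i)\prod_{j=n+i+1}^{2n}\delta(u\tfrac{x_i}{x_j},h)\Big).$$ For general $\mathcal P=\sigma^\mu w\mathcal P^{\min}_{2n,n}$ with $w$ of minimal possible length and reduced word $w=s_{i_1}\cdots s_{i_\ell}$, $\mathcal E\ell\ell(\mathcal P)=\sigma^\mu\,\mathfrak C_{i_1}^{\nu_1}\cdots\mathfrak C_{i_\ell}^{\nu_\ell}(\mathcal E\ell\ell(\mathcal P^{\min}_{2n,n}))$ with each $\nu_k$ admissible; this is independent of choices. **Reduced class.** If all targets are $\le n$ then all sources are $>n$; the permutation $w_{\mathcal P}$ is defined by: the arrow with source $n+j$ has target $w_{\mathcal P}(j)$. The arrow with source $n+j$ carries the label $j$. Put $u=1$, $x_{j+n}=y_j$ and $$\mathcal E\ell\ell^{\rm red}(\mathcal P)=\frac{\prod_{i=1}^n\prod_{j=1}^n\vartheta(\tfrac{x_i}{y_j})\cdot\mathcal E\ell\ell(\mathcal P)}{\prod_{n\ge i>j\ge1}\vartheta(\tfrac{y_i}{y_j})\cdot\prod_{1\le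 i<j\le n}\frac{\vartheta(\frac{y_i}{y_j}h)}{\vartheta(h)}}.$$ **Elliptic classes of Schubert varieties.** $X_w$ is the closure of the $\mathrm B_n$-orbit of the permutation matrix of $w$ in $\mathcal F\ell_n$; torus-fixed points are identified with $\sigma\in\mathfrak S_n$. The equivariant Borisov–Libgober elliptic class of $X_w$ with the boundary divisor determined by a fractional line bundle (encoded by the variables $\mu_i$), divided by the elliptic Euler class of the tangent bundle, is denoted $\mathcal E\ell\ell(X_w)$. Its restrictions to fixed points are known to be determined by: $\mathcal E\ell\ell(X_{\rm id})_{|\sigma}=1$ if $\sigma=\mathrm{id}$ and $0$ otherwise, and the R-matrix recursion, for $1\le i<n$ and $\ell(s_iw)>\ell(w)$, $$\mathcal E\ell\ell(X_{s_iw})_{|\sigma}=\delta\big(\tfrac{x_{i+1}}{x_i},\tfrac{\mu_{w^{-1}(i+1)}}{\mu_{w^{-1}(i)}}\big)\,\mathcal E\ell\ell(X_w)_{|\sigma}+\delta\big(\tfrac{x_i}{x_{i+1}},h\big)\,s_i\big(\mathcal E\ell\ell(X_w)_{|s_i\sigma}\big).$$ *)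

theory Defs
  imports "HOL-Analysis.Analysis" "HOL-Library.Poly_Mapping" "HOL-Combinatorics.Permutations"
begin

section \<open>Theta functions\<close>

text \<open>
  Everything is written additively: a multiplicative variable \<open>a\<close> stands for \<open>exp (2 \<pi> i x)\<close>
  and is represented by \<open>x\<close>, so products become sums, \<open>u = 1\<close> becomes \<open>u = 0\<close> and
  \<open>\<mu>\<^sub>i := \<mu>\<^sub>i\<^sup>-\<^sup>1\<close> becomes \<open>\<mu>\<^sub>i := - \<mu>\<^sub>i\<close>.
\<close>

definition nome :: "complex \<Rightarrow> complex" where
  "nome \<tau> = exp (2 * of_real pi * \<i> * \<tau>)"

definition theta :: "complex \<Rightarrow> complex \<Rightarrow> complex" where
  "theta \<tau> x =
     2 * exp (2 * of_real pi * \<i> * \<tau> / 8) * sin (of_real pi * x) *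
     prodinf (\<lambda>k. (1 - nome \<tau> ^ Suc k) *
                  (1 - nome \<tau> ^ Suc k * exp (2 * of_real pi * \<i> * x)) *
                  (1 - nome \<tau> ^ Suc k * exp (- (2 * of_real pi * \<i> * x))))"

definition F :: "complex \<Rightarrow> complex \<Rightarrow> complex \<Rightarrow> complex" where
  "F \<tau> x y = deriv (theta \<tau>) 0 * theta \<tau> (x + y) / (theta \<tau> x * theta \<tau> y)"

definition vtheta :: "complex \<Rightarrow> complex \<Rightarrow> complex" where
  "vtheta \<tau> x = theta \<tau> x / deriv (theta \<tau>) 0"

lemma F_eq_vtheta: "F \<tau> x y = vtheta \<tau> (x + y) / (vtheta \<tau> x * vtheta \<tau> y)"
  by (cases "deriv (theta \<tau>) 0 = 0") (auto simp: F_def vtheta_def)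

definition period_lattice :: "complex \<Rightarrow> complex set" where
  "period_lattice \<tau> = {of_int a + of_int b * \<tau> | a b. True}"


section \<open>Laurent polynomials in theta functions\<close>

datatype var = X nat | Mu nat | H | U

text \<open>
  \<open>form\<close>: integral linear combinations of the variables.
  \<open>theta_mono\<close>: formal products of integral powers of \<open>\<theta>(\<ell>)\<close>; the group of such products is
  written additively, so \<open>frag_of \<ell>\<close> is the factor \<open>\<theta>(\<ell>)\<close> and \<open>- frag_of \<ell>\<close> its inverse.
  \<open>theta_poly\<close>: the group ring of \<open>theta_mono\<close>, with the convolution product of \<open>Poly_Mapping\<close>.
  Types are attached to these expressions, not to the functions they denote.
\<close>

type_synonym form = "var \<Rightarrow>\<^sub>0 int"
type_synonym theta_mono = "form \<Rightarrow>\<^sub>0 int"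
type_synonym theta_poly = "theta_mono \<Rightarrow>\<^sub>0 int"

definition form_val :: "(var \<Rightarrow> complex) \<Rightarrow> form \<Rightarrow> complex" where
  "form_val v l = (\<Sum>a\<in>Poly_Mapping.keys l. of_int (Poly_Mapping.lookup l a) * v a)"

definition mono_val :: "complex \<Rightarrow> (var \<Rightarrow> complex) \<Rightarrow> theta_mono \<Rightarrow> complex" where
  "mono_val \<tau> v m =
     (\<Prod>l\<in>Poly_Mapping.keys m. vtheta \<tau> (form_val v l) powi Poly_Mapping.lookup m l)"

definition poly_val :: "complex \<Rightarrow> (var \<Rightarrow> complex) \<Rightarrow> theta_poly \<Rightarrow> complex" where
  "poly_val \<tau> v f =
     (\<Sum>m\<in>Poly_Mapping.keys f. of_int (Poly_Mapping.lookup f m) * mono_val \<tau> v m)"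

text \<open>The type, a quadratic form in the variables, is given as a polynomial function.\<close>

definition mono_type :: "theta_mono \<Rightarrow> (var \<Rightarrow> complex) \<Rightarrow> complex" where
  "mono_type m v =
     (\<Sum>l\<in>Poly_Mapping.keys m. of_int (Poly_Mapping.lookup m l) * ((form_val v l)\<^sup>2 / 2))"

definition pure :: "theta_poly \<Rightarrow> bool" where
  "pure f \<longleftrightarrow> (\<forall>m\<in>Poly_Mapping.keys f. \<forall>m'\<in>Poly_Mapping.keys f. mono_type m = mono_type m')"

definition delta :: "form \<Rightarrow> form \<Rightarrow> theta_poly" where
  "delta a b = frag_of (frag_of (a + b) - frag_of a - frag_of b)"

text \<open>Substitution of variables for variables.\<close>

definition form_subst :: "(var \<Rightarrow> var) \<Rightarrow> form \<Rightarrow> form" where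
  "form_subst g = frag_extend (\<lambda>a. frag_of (g a))"

definition mono_subst :: "(var \<Rightarrow> var) \<Rightarrow> theta_mono \<Rightarrow> theta_mono" where
  "mono_subst g = frag_extend (\<lambda>l. frag_of (form_subst g l))"

definition poly_subst :: "(var \<Rightarrow> var) \<Rightarrow> theta_poly \<Rightarrow> theta_poly" where
  "poly_subst g = frag_extend (\<lambda>m. frag_of (mono_subst g m))"

fun x_perm :: "(nat \<Rightarrow> nat) \<Rightarrow> var \<Rightarrow> var" where
  "x_perm p (X k) = X (p k)"
| "x_perm p a = a"

fun mu_perm :: "(nat \<Rightarrow> nat) \<Rightarrow> var \<Rightarrow> var" where
  "mu_perm p (Mu k) = Mu (p k)"
| "mu_perm p a = a"

abbreviation sw :: "nat \<Rightarrow> nat \<Rightarrow> nat" where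
  "sw i \<equiv> Transposition.transpose i (Suc i)"

definition C_op :: "nat \<Rightarrow> form \<Rightarrow> theta_poly \<Rightarrow> theta_poly" where
  "C_op i \<nu> f =
     delta (frag_of (X (Suc i)) - frag_of (X i)) \<nu> * f
     + delta (frag_of (X i) - frag_of (X (Suc i))) (frag_of H) * poly_subst (x_perm (sw i)) f"

text \<open>
  The last conjunct is \<open>\<nu> = (type f - s\<^sub>i type f) / (x\<^sub>i - x\<^sub>i\<^sub>+\<^sub>1) - h\<close> with the denominator
  cleared, as an identity of polynomial functions.
\<close>

definition admissible :: "nat \<Rightarrow> nat \<Rightarrow> theta_poly \<Rightarrow> form \<Rightarrow> bool" where
  "admissible n i f \<nu> \<longleftrightarrow>
     \<nu> \<noteq> 0 \<and> Poly_Mapping.keys \<nu> \<subseteq> insert H (Mu ` {1..n}) \<and> pure f \<and>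
     (\<forall>m\<in>Poly_Mapping.keys f. \<forall>v.
        (v (X i) - v (X (Suc i))) * (form_val v \<nu> + v H)
        = mono_type m v - mono_type m (v \<circ> x_perm (sw i)))"


section \<open>Permutations\<close>

text \<open>Permutations of \<open>{1..m}\<close> are functions on \<open>nat\<close> fixing everything outside \<open>{1..m}\<close>.\<close>

definition perm_length :: "(nat \<Rightarrow> nat) \<Rightarrow> nat" where
  "perm_length w = card {(i, j). i < j \<and> w j < w i}"

definition word_perm :: "nat list \<Rightarrow> nat \<Rightarrow> nat" where
  "word_perm js = foldr (\<lambda>i w. sw i \<circ> w) js id"

definition reduced_word :: "nat \<Rightarrow> (nat \<Rightarrow> nat) \<Rightarrow> nat list \<Rightarrow> bool" where
  "reduced_word m w js \<longleftrightarrow>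
     set js \<subseteq> {1..<m} \<and> word_perm js = w \<and> length js = perm_length w"


section \<open>Link patterns and their classes\<close>

text \<open>\<open>P i = (a\<^sub>i, b\<^sub>i)\<close> is the (source, target) pair of the arrow labelled \<open>i\<close>, \<open>1 \<le> i \<le> n\<close>.\<close>

type_synonym link_pattern = "nat \<Rightarrow> nat \<times> nat"

definition labelled_link_pattern :: "nat \<Rightarrow> link_pattern \<Rightarrow> bool" where
  "labelled_link_pattern n P \<longleftrightarrow>
     (\<forall>i\<in>{1..n}. fst (P i) \<in> {1..2*n} \<and> snd (P i) \<in> {1..2*n}) \<and>
     inj_on (\<lambda>i. fst (P i)) {1..n} \<and> inj_on (\<lambda>i. snd (P i)) {1..n} \<and>
     (\<forall>i\<in>{1..n}. \<forall>j\<in>{1..n}. fst (P i) \<noteq> snd (P j))"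

definition min_pattern :: "nat \<Rightarrow> link_pattern" where
  "min_pattern n i = (n + i, i)"

text \<open>\<open>P = \<sigma>\<^sup>\<mu> w P\<^sup>m\<^sup>i\<^sup>n\<close>: the arrow of \<open>w P\<^sup>m\<^sup>i\<^sup>n\<close> labelled \<open>i\<close> gets the label \<open>\<sigma> i\<close>.\<close>

definition presents :: "nat \<Rightarrow> (nat \<Rightarrow> nat) \<Rightarrow> (nat \<Rightarrow> nat) \<Rightarrow> link_pattern \<Rightarrow> bool" where
  "presents n \<sigma> w P \<longleftrightarrow>
     \<sigma> permutes {1..n} \<and> w permutes {1..2*n} \<and>
     (\<forall>i\<in>{1..n}. P (\<sigma> i) = map_prod w w (min_pattern n i))"

definition min_class :: "nat \<Rightarrow> theta_poly" where
  "min_class n =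
     (\<Prod>i=1..n. delta (frag_of U + frag_of (X i) - frag_of (X (n + i))) (frag_of (Mu i)) *
        (\<Prod>j=n+i+1..2*n. delta (frag_of U + frag_of (X i) - frag_of (X j)) (frag_of H)))"

inductive word_class :: "nat \<Rightarrow> nat list \<Rightarrow> theta_poly \<Rightarrow> bool" for n :: nat where
  Nil: "word_class n [] (min_class n)"
| Cons: "word_class n js g \<Longrightarrow> admissible n i g \<nu> \<Longrightarrow> word_class n (i # js) (C_op i \<nu> g)"

text \<open>
  \<open>link_class n P f\<close>: the expression \<open>f\<close> arises as the class of \<open>P\<close> for some choice of
  \<open>\<sigma>\<close>, of \<open>w\<close> (of minimal length over all \<open>\<sigma>\<close>) and of a reduced word. Different choices give
  different expressions of the same function.
\<close>

definition link_class :: "nat \<Rightarrow> link_pattern \<Rightarrow> theta_poly \<Rightarrow> bool" where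
  "link_class n P f \<longleftrightarrow>
     (\<exists>\<sigma> w js g. presents n \<sigma> w P \<and>
        (\<forall>\<sigma>' w'. presents n \<sigma>' w' P \<longrightarrow> perm_length w \<le> perm_length w') \<and>
        reduced_word (2*n) w js \<and> word_class n js g \<and> f = poly_subst (mu_perm \<sigma>) g)"


section \<open>The reduced class\<close>

definition target_perm :: "nat \<Rightarrow> link_pattern \<Rightarrow> nat \<Rightarrow> nat" where
  "target_perm n P j =
     (if j \<in> {1..n} then (THE b. \<exists>i\<in>{1..n}. P i = (n + j, b)) else j)"

fun assignment ::
  "nat \<Rightarrow> (nat \<Rightarrow> complex) \<Rightarrow> (nat \<Rightarrow> complex) \<Rightarrow> (nat \<Rightarrow> complex) \<Rightarrow> complex \<Rightarrow> var \<Rightarrow> complex"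
where
  "assignment n x y \<mu> h (X k) = (if k \<le> n then x k else y (k - n))"
| "assignment n x y \<mu> h (Mu k) = \<mu> k"
| "assignment n x y \<mu> h H = h"
| "assignment n x y \<mu> h U = 0"

definition reduced_class ::
  "nat \<Rightarrow> complex \<Rightarrow> theta_poly \<Rightarrow>
   (nat \<Rightarrow> complex) \<Rightarrow> (nat \<Rightarrow> complex) \<Rightarrow> (nat \<Rightarrow> complex) \<Rightarrow> complex \<Rightarrow> complex"
where
  "reduced_class n \<tau> f x y \<mu> h =
     ((\<Prod>i=1..n. \<Prod>j=1..n. vtheta \<tau> (x i - y j)) * poly_val \<tau> (assignment n x y \<mu> h) f) /
     ((\<Prod>i=1..n. \<Prod>j\<in>{1..<i}. vtheta \<tau> (y i - y j)) *
      (\<Prod>i=1..n. \<Prod>j\<in>{i<..n}. vtheta \<tau> (y i - y j + h) / vtheta \<tau> h))"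

text \<open>
  No denominator in \<open>reduced_class\<close> that involves \<open>y\<close> vanishes on this set. The point
  \<open>y\<^sub>i = x\<^sub>\<sigma>\<^sub>(\<^sub>i\<^sub>)\<close> is in its closure but not in the set: there zeros of \<open>vtheta \<tau> (x i - y j)\<close> meet
  poles of the class, and the value of the meromorphic function at the point is its limit along
  the set. (A meromorphic function with a finite limit along the complement of its polar
  hyperplanes is holomorphic at the point.)
\<close>

definition regular_points :: "nat \<Rightarrow> complex \<Rightarrow> (nat \<Rightarrow> complex) \<Rightarrow> complex \<Rightarrow> (nat \<Rightarrow> complex) set"
where
  "regular_points n \<tau> x h =
     {y. \<forall>i\<in>{1..n}. \<forall>j\<in>{1..n}. x i - y j \<notin> period_lattice \<tau> \<and>
        (i \<noteq> j \<longrightarrow> y i - y j \<notin> period_lattice \<tau> \<and> y i - y j + h \<notin> period_lattice \<tau>)}"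


section \<open>Elliptic classes of Schubert varieties\<close>

definition generic ::
  "nat \<Rightarrow> complex \<Rightarrow> (nat \<Rightarrow> complex) \<Rightarrow> (nat \<Rightarrow> complex) \<Rightarrow> complex \<Rightarrow> bool"
where
  "generic n \<tau> x \<mu> h \<longleftrightarrow>
     h \<notin> period_lattice \<tau> \<and> (\<forall>i\<in>{1..n}. \<mu> i \<notin> period_lattice \<tau>) \<and>
     (\<forall>i\<in>{1..n}. \<forall>j\<in>{1..n}. i \<noteq> j \<longrightarrow>
        x i - x j \<notin> period_lattice \<tau> \<and> x i - x j + h \<notin> period_lattice \<tau> \<and>
        \<mu> i - \<mu> j \<notin> period_lattice \<tau>)"

text \<open>
  \<open>E w \<sigma> x \<mu> h\<close> is the restriction to the fixed point \<open>\<sigma>\<close> of the elliptic class of \<open>X\<^sub>w\<close>. The class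
  is specified by the relations that determine all its restrictions. They are identities of
  meromorphic functions and are required only at generic arguments, away from all poles: at
  the poles the convention \<open>a / 0 = 0\<close> would make them meaningless. Generic arguments are stable
  under permutations of the \<open>x\<^sub>i\<close>.
\<close>

definition schubert_elliptic_classes ::
  "nat \<Rightarrow> complex \<Rightarrow>
   ((nat \<Rightarrow> nat) \<Rightarrow> (nat \<Rightarrow> nat) \<Rightarrow> (nat \<Rightarrow> complex) \<Rightarrow> (nat \<Rightarrow> complex) \<Rightarrow> complex \<Rightarrow> complex) \<Rightarrow> bool"
where
  "schubert_elliptic_classes n \<tau> E \<longleftrightarrow>
     (\<forall>\<sigma> x \<mu> h. \<sigma> permutes {1..n} \<longrightarrow> generic n \<tau> x \<mu> h \<longrightarrow>
        E id \<sigma> x \<mu> h = (if \<sigma> = id then 1 else 0)) \<and>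
     (\<forall>w \<sigma> i x \<mu> h. w permutes {1..n} \<longrightarrow> \<sigma> permutes {1..n} \<longrightarrow> 1 \<le> i \<longrightarrow> i < n \<longrightarrow>
        perm_length (sw i \<circ> w) > perm_length w \<longrightarrow> generic n \<tau> x \<mu> h \<longrightarrow>
        E (sw i \<circ> w) \<sigma> x \<mu> h =
          F \<tau> (x (Suc i) - x i) (\<mu> (inv w (Suc i)) - \<mu> (inv w i)) * E w \<sigma> x \<mu> h
          + F \<tau> (x i - x (Suc i)) h * E w (sw i \<circ> \<sigma>) (x \<circ> sw i) \<mu> h)"

end

theory Submission
  imports Defs "HOL-Complex_Analysis.Cauchy_Integral_Formula"
begin

text \<open>
  A permutation \<open>w\<close> presenting \<open>P\<close> preserves the blocks of targets and of sources, so a reduced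
  word of it mixes crossings \<open>s\<^sub>i\<close> of targets with crossings \<open>s\<^sub>n\<^sub>+\<^sub>i\<close> of sources, which commute.
  On the minimal pattern a crossing of the sources \<open>n + i\<close> and \<open>n + i + 1\<close> has the same effect as
  the crossing of the targets \<open>i\<close> and \<open>i + 1\<close> followed by an exchange of the labels; this is a
  consequence of the three-term identity for \<open>\<theta>\<close>. Hence every class of \<open>P\<close> is obtained from target
  crossings alone, along a reduced word of \<open>w\<^sub>P\<close>. The admissible parameter is then \<open>\<mu>\<^sub>a - \<mu>\<^sub>b\<close>
  with \<open>w(a) = i\<close> and \<open>w(b) = i + 1\<close>, so that the recursion of the classes is, up to the sign of
  \<open>\<mu>\<close>, the R-matrix recursion of the Schubert varieties; the reducing factor is symmetric in \<open>x\<close>.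
  For the minimal pattern the reduced class has no pole at \<open>y = x \<circ> \<sigma>\<close>, and it vanishes there
  unless \<open>\<sigma> = id\<close> because some \<open>i\<close> has \<open>\<sigma>(i) > i\<close>.
\<close>

section \<open>The theta function\<close>

text \<open>Types belong to formal expressions, whereas trading a source crossing for a target
  crossing is an identity between functions only. The two levels are bridged once: the type of an
  expression built along a word is a quadratic form depending on the permutation of the word alone.
  This pins down every admissible parameter, and evaluation then turns the expression into the
  explicit recursion \<open>wval\<close>. From there on only values at generic points occur.

  \<open>link_class\<close> leaves the relabelling, the permutation and the reduced word open, so
  all of them are treated at once. Each source crossing is traded for exactly one target crossing,
  so the target word is as long as the minimal \<open>w\<close>. Since \<open>id\<close> and
  \<open>target_perm n P\<close> also present \<open>P\<close>, minimality makes that word reduced.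
  The Schubert recursion holds along every reduced word, so whichever word arises will serve.

  The point y = x \<circ> \<sigma> lies on poles of the class. The coefficients of the recursion do
  not involve y, so a limit has to be computed directly for the empty word only.\<close>

definition qprod :: "complex \<Rightarrow> complex \<Rightarrow> complex" where
  "qprod q z = prodinf (\<lambda>k. 1 - q ^ Suc k * z)"

context
  fixes q :: complex
  assumes q: "norm q < 1"
begin

lemma summable_qprod: "summable (\<lambda>k. norm (q ^ Suc k * z))"
  using summable_mult2[OF summable_mult[OF summable_geometric[of "norm q"]], of "norm q" "norm z"] q
  by (simp add: norm_mult norm_power)

lemma convergent_qprod: "convergent_prod (\<lambda>k. 1 - q ^ Suc k * z)"
proof -
  have "abs_convergent_prod (\<lambda>k. 1 + - (q ^ Suc k * z))"
    using summable_qprod[of z] by (intro summable_imp_abs_convergent_prod) (simp del: power_Suc)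
  then show ?thesis
    using abs_convergent_prod_imp_convergent_prod by fastforce
qed

lemma qprod_eq_0_iff: "qprod q z = 0 \<longleftrightarrow> (\<exists>k. q ^ Suc k * z = 1)"
proof -
  have "qprod q z = 0 \<longleftrightarrow> 0 \<in> range (\<lambda>k. 1 - q ^ Suc k * z)"
    using has_prod_eq_0_iff[OF convergent_prod_has_prod[OF convergent_qprod]]
    unfolding qprod_def .
  then show ?thesis
    by (auto simp: image_iff)
qed

lemma qprod_shift: "qprod q z = (1 - q * z) * qprod q (q * z)"
proof (cases "1 - q * z = 0")
  case True
  then have "q ^ Suc 0 * z = 1" by simp
  then have "qprod q z = 0" using qprod_eq_0_iff by blast
  with True show ?thesis by simp
next
  case False
  have "prodinf (\<lambda>n. 1 - q ^ Suc (Suc n) * z) = qprod q z / (1 - q ^ Suc 0 * z)"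
    unfolding qprod_def by (rule prodinf_split_head[OF convergent_qprod]) (use False in simp)
  moreover have "prodinf (\<lambda>n. 1 - q ^ Suc (Suc n) * z) = qprod q (q * z)"
    unfolding qprod_def by (simp add: mult_ac)
  ultimately show ?thesis
    using False by (simp add: field_simps)
qed

lemma holomorphic_qprod: "qprod q holomorphic_on UNIV"
proof (rule holomorphic_uniform_sequence)
  fix z :: complex
  let ?K = "cball z 1"
  have "uniformly_convergent_on ?K (\<lambda>N x. \<Prod>k<N. 1 - q ^ Suc k * x)"
  proof (rule uniformly_convergent_on_prod')
    have "uniformly_convergent_on ?K (\<lambda>N x. \<Sum>k<N. norm (- (q ^ Suc k * x)))"
    \<comment> \<open>All arguments in the closed unit disc about \<open>z\<close> have norm at most
      |z| + 1, so the geometric series for that one argument dominates.\<close>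
    proof (rule Weierstrass_m_test'[where M = "\<lambda>k. norm (q ^ Suc k * of_real (norm z + 1))"])
      show "summable (\<lambda>k. norm (q ^ Suc k * of_real (norm z + 1)))"
        by (rule summable_qprod)
      show "norm (norm (- (q ^ Suc k * x))) \<le> norm (q ^ Suc k * of_real (norm z + 1))"
        if "x \<in> ?K" for k x
      proof -
        have "norm x \<le> norm z + 1"
          using that norm_triangle_ineq2[of x z] by (simp add: dist_norm norm_minus_commute)
        moreover have "norm (of_real (norm z + 1) :: complex) = norm z + 1"
          by (smt (verit) norm_ge_zero norm_of_real)
        ultimately show ?thesis
          by (simp only: norm_mult norm_minus_cancel) (simp add: mult_left_mono)
      qed
    qed
    then show "uniformly_convergent_on ?K (\<lambda>N x. \<Sum>k<N. norm (1 - q ^ Suc k * x - 1))"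
      by simp
  qed (auto intro!: continuous_intros)
  then have "uniform_limit ?K (\<lambda>N x. \<Prod>k<N. 1 - q ^ Suc k * x)
      (\<lambda>x. lim (\<lambda>N. \<Prod>k<N. 1 - q ^ Suc k * x)) sequentially"
    by (simp add: uniformly_convergent_uniform_limit_iff)
  moreover have "lim (\<lambda>N. \<Prod>k<N. 1 - q ^ Suc k * x) = qprod q x" for x
    unfolding qprod_def by (rule limI[OF has_prod_imp_tendsto'[OF convergent_prod_has_prod[OF convergent_qprod]]])
  ultimately have "uniform_limit ?K (\<lambda>N x. \<Prod>k<N. 1 - q ^ Suc k * x) (qprod q) sequentially"
    by simp
  then show "\<exists>d>0. cball z d \<subseteq> UNIV \<and>
      uniform_limit (cball z d) (\<lambda>N x. \<Prod>k<N. 1 - q ^ Suc k * x) (qprod q) sequentially"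
    by (intro exI[of _ 1]) simp
qed (auto intro!: holomorphic_intros)

end

section \<open>Zeros, quasi-periods and derivative of theta\<close>

locale upper_half =
  fixes \<tau> :: complex
  assumes Im_tau: "Im \<tau> > 0"
begin

abbreviation ex :: "complex \<Rightarrow> complex" where
  "ex x \<equiv> exp (2 * of_real pi * \<i> * x)"

lemma norm_nome: "norm (nome \<tau>) < 1"
  using Im_tau by (simp add: nome_def)

text \<open>\<open>qprod q z\<close> is the q-Pochhammer symbol (qz; q) of infinite length. With the
  product split into three of them, zeros, shifts and holomorphy can be read off factor by
  factor.\<close>

lemma theta_eq:
  "theta \<tau> x = 2 * exp (2 * of_real pi * \<i> * \<tau> / 8) * sin (of_real pi * x) *
     (qprod (nome \<tau>) 1 * qprod (nome \<tau>) (ex x) * qprod (nome \<tau>) (ex (- x)))"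
proof -
  note c = convergent_qprod[OF norm_nome]
  have "qprod (nome \<tau>) 1 * qprod (nome \<tau>) (ex x) * qprod (nome \<tau>) (ex (- x)) =
     prodinf (\<lambda>k. (1 - nome \<tau> ^ Suc k * 1) * (1 - nome \<tau> ^ Suc k * ex x) *
           (1 - nome \<tau> ^ Suc k * ex (- x)))"
    unfolding qprod_def
    by (subst prodinf_mult[OF c c], subst prodinf_mult[OF convergent_prod_mult[OF c c] c]) (rule refl)
  then show ?thesis
    unfolding theta_def by (simp only: mult_1_right mult_minus_right)
qed

lemma holomorphic_theta [holomorphic_intros]:
  assumes "f holomorphic_on A"
  shows "(\<lambda>x. theta \<tau> (f x)) holomorphic_on A"
proof -
  have 1: "(\<lambda>x. qprod (nome \<tau>) (g x)) holomorphic_on UNIV" if "g holomorphic_on UNIV" for g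
    using holomorphic_on_compose_gen[OF that holomorphic_qprod[OF norm_nome]] by (simp add: o_def)
  have "theta \<tau> holomorphic_on UNIV"
    unfolding theta_eq[abs_def] by (intro holomorphic_intros 1)
  then show ?thesis
    using holomorphic_on_compose_gen[OF assms, of "theta \<tau>" UNIV] by (simp add: o_def)
qed

lemma isCont_theta: "isCont (theta \<tau>) x"
  using holomorphic_on_imp_continuous_on[OF holomorphic_theta[OF holomorphic_on_ident, of UNIV]]
  by (simp add: continuous_on_eq_continuous_at)

lemma ex_eq_1_iff: "ex x = 1 \<longleftrightarrow> (\<exists>m::int. x = of_int m)"
proof -
  have "ex x = 1 \<longleftrightarrow> (\<exists>m::int. - (2 * pi * Im x) = 0 \<and> 2 * pi * Re x = of_int (2 * m) * pi)"
    unfolding exp_eq_1 by simp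
  also have "\<dots> \<longleftrightarrow> (\<exists>m::int. Im x = 0 \<and> Re x = of_int m)"
    by (auto simp: mult_ac)
  also have "\<dots> \<longleftrightarrow> (\<exists>m::int. x = of_int m)"
    by (auto simp: complex_eq_iff)
  finally show ?thesis .
qed

lemma nome_power: "nome \<tau> ^ k = ex (of_nat k * \<tau>)"
  by (simp add: nome_def exp_of_nat_mult[symmetric] mult_ac)

lemma sin_pi_eq_0_iff: "sin (of_real pi * x) = 0 \<longleftrightarrow> (\<exists>m::int. x = of_int m)" for x :: complex
proof -
  have "sin (of_real pi * x) = 0 \<longleftrightarrow> (\<exists>m::int. of_real pi * x = of_real pi * of_int m)"
    unfolding sin_eq_0 by (simp add: mult_ac)
  then show ?thesis by simp
qed

lemma qprod_1_neq_0: "qprod (nome \<tau>) 1 \<noteq> 0"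
proof -
  have "nome \<tau> ^ Suc k * 1 \<noteq> 1" for k
  proof -
    have "norm (nome \<tau> ^ Suc k) < 1"
      using norm_nome by (simp add: norm_power power_less_one_iff del: power_Suc)
    then show ?thesis by auto
  qed
  then show ?thesis
    unfolding qprod_eq_0_iff[OF norm_nome] by blast
qed

lemma theta_eq_0_iff: "theta \<tau> x = 0 \<longleftrightarrow> x \<in> period_lattice \<tau>"
proof -
  have e: "nome \<tau> ^ Suc k * ex y = 1 \<longleftrightarrow> (\<exists>m::int. y = of_int m - of_nat (Suc k) * \<tau>)" for k y
  proof -
    have "nome \<tau> ^ Suc k * ex y = ex (of_nat (Suc k) * \<tau> + y)"
      by (simp only: nome_power exp_add[symmetric] distrib_left)
    moreover have "of_nat (Suc k) * \<tau> + y = of_int m \<longleftrightarrow> y = of_int m - of_nat (Suc k) * \<tau>" for m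
      by (auto simp add: algebra_simps simp del: of_nat_Suc)
    ultimately show ?thesis
      by (simp only: ex_eq_1_iff)
  qed
  note z = qprod_eq_0_iff[OF norm_nome]
  have "theta \<tau> x = 0 \<longleftrightarrow> (\<exists>m::int. x = of_int m) \<or>
      (\<exists>k. \<exists>m::int. x = of_int m - of_nat (Suc k) * \<tau>) \<or>
      (\<exists>k. \<exists>m::int. - x = of_int m - of_nat (Suc k) * \<tau>)"
    unfolding theta_eq mult_eq_0_iff z[of "ex x"] z[of "ex (- x)"] e sin_pi_eq_0_iff
    using qprod_1_neq_0 by auto
  also have "\<dots> \<longleftrightarrow> x \<in> period_lattice \<tau>"
  proof
    assume "x \<in> period_lattice \<tau>"
    then obtain a b where x: "x = of_int a + of_int b * \<tau>"
      by (auto simp: period_lattice_def)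
    \<comment> \<open>The sign of \<open>b\<close> tells which factor vanishes: the sine for b = 0,
      \<open>qprod\<close> at \<open>ex x\<close> for b < 0, \<open>qprod\<close> at
      \<open>ex (- x)\<close> for b > 0.\<close>
    consider "b = 0" | k where "b = - int (Suc k)" | k where "b = int (Suc k)"
      by (metis int_cases not0_implies_Suc of_nat_0)
    then show "(\<exists>m::int. x = of_int m) \<or>
      (\<exists>k. \<exists>m::int. x = of_int m - of_nat (Suc k) * \<tau>) \<or>
      (\<exists>k. \<exists>m::int. - x = of_int m - of_nat (Suc k) * \<tau>)"
    proof cases
      case 3
      then have "- x = of_int (- a) - of_nat (Suc k) * \<tau>"
        unfolding x by simp
      then show ?thesis by blast
    next
      case 2
      then have b: "of_int b = - (of_nat (Suc k) :: complex)"
        by simp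
      have "x = of_int a - of_nat (Suc k) * \<tau>"
        unfolding x b by (simp only: mult_minus_left add_uminus_conv_diff)
      then show ?thesis by blast
    qed (auto simp: x)
  next
    have "- x \<in> period_lattice \<tau> \<Longrightarrow> x \<in> period_lattice \<tau>"
      by (auto simp: period_lattice_def) (metis add.inverse_inverse minus_add_distrib mult_minus_left of_int_minus)
    moreover have "of_int m \<in> period_lattice \<tau>" "of_int m - of_nat k * \<tau> \<in> period_lattice \<tau>" for m k
      unfolding period_lattice_def
      by (rule CollectI, rule exI[of _ m], rule exI[of _ 0], simp,
          rule CollectI, rule exI[of _ m], rule exI[of _ "- int k"], simp)
    moreover assume "(\<exists>m::int. x = of_int m) \<or>
      (\<exists>k. \<exists>m::int. x = of_int m - of_nat (Suc k) * \<tau>) \<or>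
      (\<exists>k. \<exists>m::int. - x = of_int m - of_nat (Suc k) * \<tau>)"
    ultimately show "x \<in> period_lattice \<tau>"
      by metis
  qed
  finally show ?thesis .
qed

lemma theta_minus: "theta \<tau> (- x) = - theta \<tau> x"
  unfolding theta_eq by (simp add: mult_ac)

lemma theta_plus_1: "theta \<tau> (x + 1) = - theta \<tau> x"
proof -
  have e: "ex (x + 1) = ex x"
    by (simp add: distrib_left exp_add)
  then have "ex (- (x + 1)) = ex (- x)"
    by (simp only: mult_minus_right exp_minus)
  moreover have "sin (of_real pi * (x + 1)) = - sin (of_real pi * x)"
    by (simp add: algebra_simps sin_add)
  ultimately show ?thesis
    unfolding theta_eq using e by simp
qed

text \<open>The shift multiplies \<open>ex x\<close> by the nome, so by \<open>qprod_shift\<close>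
  one factor leaves one product and another factor enters the other product. What remains is a
  rational identity in the half-exponentials \<open>?s\<close> and \<open>?t\<close>, claim
  \<open>6\<close> of the proof.\<close>

lemma theta_plus_tau: "theta \<tau> (x + \<tau>) = - exp (- (of_real pi * \<i> * (2 * x + \<tau>))) * theta \<tau> x"
proof -
  let ?q = "nome \<tau>" and ?s = "exp (of_real pi * \<i> * x)" and ?t = "exp (of_real pi * \<i> * \<tau>)"
  have ne: "?s \<noteq> 0" "?t \<noteq> 0" by auto
  have q: "?q = ?t\<^sup>2" "ex x = ?s\<^sup>2" "ex (- x) = 1 / ?s\<^sup>2"
    by (simp_all add: nome_def exp_double[symmetric] exp_minus inverse_eq_divide mult_ac)
  have e: "ex (x + \<tau>) = ?q * ex x"
    by (simp add: nome_def exp_add distrib_left)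
  then have e': "ex (- (x + \<tau>)) = 1 / (?q * ex x)"
    by (simp only: mult_minus_right exp_minus inverse_eq_divide)
  have sin: "sin (of_real pi * y) =
      (exp (of_real pi * \<i> * y) - 1 / exp (of_real pi * \<i> * y)) / (2 * \<i>)" for y
    by (simp add: sin_exp_eq exp_minus mult_ac field_simps)
  have 1: "qprod ?q (ex x) = (1 - ?t\<^sup>2 * ?s\<^sup>2) * qprod ?q (?q * ex x)"
    using qprod_shift[OF norm_nome, of "ex x"] q by simp
  have 2: "qprod ?q (1 / (?q * ex x)) = (1 - 1 / ?s\<^sup>2) * qprod ?q (ex (- x))"
    using qprod_shift[OF norm_nome, of "1 / (?q * ex x)"] q ne by simp
  have 3: "sin (of_real pi * (x + \<tau>)) = (?s * ?t - 1 / (?s * ?t)) / (2 * \<i>)"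
    unfolding sin by (simp add: ring_distribs exp_add)
  have 4: "sin (of_real pi * x) = (?s - 1 / ?s) / (2 * \<i>)"
    by (rule sin)
  have 5: "exp (- (of_real pi * \<i> * (2 * x + \<tau>))) = 1 / (?s\<^sup>2 * ?t)"
  proof -
    have "of_real pi * \<i> * (2 * x + \<tau>) = 2 * (of_real pi * \<i> * x) + of_real pi * \<i> * \<tau>"
      by (simp add: algebra_simps)
    then show ?thesis
      by (simp only: exp_minus exp_add exp_double inverse_eq_divide)
  qed
  have 6: "(?s * ?t - 1 / (?s * ?t)) / (2 * \<i>) * (1 - 1 / ?s\<^sup>2) =
      - (1 / (?s\<^sup>2 * ?t)) * ((?s - 1 / ?s) / (2 * \<i>)) * (1 - ?t\<^sup>2 * ?s\<^sup>2)"
    using ne by (simp add: field_simps power2_eq_square)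
  let ?R = "2 * exp (2 * of_real pi * \<i> * \<tau> / 8) * qprod ?q 1 * qprod ?q (?q * ex x) *
      qprod ?q (ex (- x))"
  have "theta \<tau> (x + \<tau>) = ?R * ((?s * ?t - 1 / (?s * ?t)) / (2 * \<i>) * (1 - 1 / ?s\<^sup>2))"
    unfolding theta_eq e e' 2 3 by (simp only: mult_ac)
  moreover have "theta \<tau> x = ?R * ((?s - 1 / ?s) / (2 * \<i>) * (1 - ?t\<^sup>2 * ?s\<^sup>2))"
    unfolding theta_eq 1 4 by (simp only: mult_ac)
  ultimately show ?thesis
    unfolding 5 6 by (simp only: mult_ac)
qed

text \<open>Near 0, theta is sin (pi x) times a product that does not vanish at 0, so only the
  derivative of the sine survives. Hence the normalization of \<open>vtheta\<close> divides by a
  nonzero number.\<close>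

lemma deriv_theta_0: "deriv (theta \<tau>) 0 \<noteq> 0"
proof -
  let ?P = "\<lambda>x. 2 * exp (2 * of_real pi * \<i> * \<tau> / 8) *
     (qprod (nome \<tau>) 1 * qprod (nome \<tau>) (ex x) * qprod (nome \<tau>) (ex (- x)))"
  have 1: "(\<lambda>x. qprod (nome \<tau>) (g x)) holomorphic_on UNIV" if "g holomorphic_on UNIV" for g
    using holomorphic_on_compose_gen[OF that holomorphic_qprod[OF norm_nome]] by (simp add: o_def)
  have "?P holomorphic_on UNIV"
    by (intro holomorphic_intros 1)
  then have P: "(?P has_field_derivative deriv ?P 0) (at 0)"
    using holomorphic_derivI[of ?P UNIV 0] by simp
  have "((\<lambda>x. sin (of_real pi * x)) has_field_derivative of_real pi) (at (0::complex))"
    by (auto intro!: derivative_eq_intros)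
  from DERIV_mult[OF this P]
  have "((\<lambda>x. sin (of_real pi * x) * ?P x) has_field_derivative of_real pi * ?P 0) (at 0)"
    by simp
  moreover have "(\<lambda>x. sin (of_real pi * x) * ?P x) = theta \<tau>"
    unfolding theta_eq[abs_def] by (simp only: mult_ac)
  ultimately have "(theta \<tau> has_field_derivative of_real pi * ?P 0) (at 0)"
    by (simp only:)
  then have "deriv (theta \<tau>) 0 = of_real pi * ?P 0"
    by (rule DERIV_imp_deriv)
  then show ?thesis
    using qprod_1_neq_0 by simp
qed

end

section \<open>Weierstrass' three-term identity\<close>

text \<open>At a simple zero of \<open>D\<close> the quotient has the limit given by l'Hopital's
  rule, so the singularity is removable.\<close>

lemma entire_quotient:
  fixes N D :: "complex \<Rightarrow> complex"
  assumes N: "N holomorphic_on UNIV" and D: "D holomorphic_on UNIV"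
    and zero: "\<And>z. D z = 0 \<Longrightarrow> N z = 0" and simple: "\<And>z. D z = 0 \<Longrightarrow> deriv D z \<noteq> 0"
  obtains G where "G holomorphic_on UNIV" "\<And>z. N z = G z * D z"
    "\<And>z. D z \<noteq> 0 \<Longrightarrow> G z = N z / D z"
proof
  define G where "G z = (if D z = 0 then deriv N z / deriv D z else N z / D z)" for z
  have G_eq: "\<And>z. D z \<noteq> 0 \<Longrightarrow> G z = N z / D z"
    by (simp add: G_def)
  have op: "open {z. D z \<noteq> 0}"
    using holomorphic_on_imp_continuous_on[OF D] by (intro open_Collect_neq) auto
  have hol: "G holomorphic_on {z. D z \<noteq> 0}"
    by (rule holomorphic_transform[of "\<lambda>z. N z / D z"])
      (auto simp: G_eq intro!: holomorphic_intros holomorphic_on_subset[OF N] holomorphic_on_subset[OF D])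
  have DN: "(N has_field_derivative deriv N z) (at z)"
      "(D has_field_derivative deriv D z) (at z)" for z
    using holomorphic_derivI[OF N, of z] holomorphic_derivI[OF D, of z] by auto
  have "G field_differentiable at z" for z
  proof (cases "D z = 0")
    case False
    then show ?thesis
      using holomorphic_on_imp_differentiable_at[OF hol op] by auto
  next
    case True
    have "((\<lambda>x. (D x - D z) / (x - z)) \<longlongrightarrow> deriv D z) (at z)"
      using DN(2)[of z] by (simp add: has_field_derivative_iff)
    then have "eventually (\<lambda>x. (D x - D z) / (x - z) \<noteq> 0) (at z)"
      by (rule tendsto_imp_eventually_ne) (rule simple[OF True])
    then have ev: "eventually (\<lambda>x. D x \<noteq> 0) (at z)"
      by eventually_elim (use True in auto)
    then obtain e where e: "e > 0" "\<And>x. x \<noteq> z \<Longrightarrow> dist x z < e \<Longrightarrow> D x \<noteq> 0"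
      unfolding eventually_at by auto
    have "((\<lambda>x. N x / D x) \<longlongrightarrow> deriv N z / deriv D z) (at z)"
      by (rule lhopital_complex_simple[OF DN]) (use True zero simple in auto)
    then have lim: "(G \<longlongrightarrow> G z) (at z)"
      unfolding G_def[of z] using True tendsto_cong[OF eventually_mono[OF ev G_eq]] by simp
    have "G holomorphic_on ball z e"
    proof (rule no_isolated_singularity'[of "{z}"])
      show "(G \<longlongrightarrow> G x) (at x within ball z e)" if "x \<in> {z}" for x
        using that tendsto_mono[OF at_le lim, of "ball z e"] by simp
      show "G holomorphic_on ball z e - {z}"
        by (rule holomorphic_on_subset[OF hol]) (use e(2) in \<open>auto simp: dist_commute\<close>)
    qed auto
    then show ?thesis
      using holomorphic_on_imp_differentiable_at[of G "ball z e" z] e(1) by simp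
  qed
  then show "G holomorphic_on UNIV"
    by (simp add: holomorphic_on_def field_differentiable_at_within)
  show "N z = G z * D z" for z
    using zero[of z] by (simp add: G_def)
  show "G z = N z / D z" if "D z \<noteq> 0" for z
    by (rule G_eq[OF that])
qed

section \<open>Doubly periodic functions and the three-term identity\<close>

context upper_half
begin

lemma theta_0 [simp]: "theta \<tau> 0 = 0"
  by (simp add: theta_eq)

lemma period_lattice_uminus: "- x \<in> period_lattice \<tau> \<longleftrightarrow> x \<in> period_lattice \<tau>"
  using theta_minus[of x] by (simp flip: theta_eq_0_iff)

text \<open>The codomain of \<open>f\<close> is left arbitrary because the lemma also serves for a
  predicate, the vanishing of a quasi-periodic function.\<close>

lemma doubly_periodic_shift:
  assumes 1: "\<And>z. f (z + 1) = f z" and t: "\<And>z. f (z + \<tau>) = f z"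
  shows "f (z + of_int a + of_int b * \<tau>) = f z"
proof -
  have n: "f (z + of_nat m * w) = f z" if "\<And>z. f (z + w) = f z" for m w z
    using that[of "z + of_nat k * w" for k] by (induction m) (simp_all add: algebra_simps)
  have i: "f (z + of_int c * w) = f z" if p: "\<And>z. f (z + w) = f z" for c w z
  proof (cases c)
    case (nonneg m)
    then show ?thesis using n[OF p] by simp
  next
    case (neg m)
    then have c: "of_int c = - (of_nat (Suc m) :: complex)" by simp
    show ?thesis
      using n[OF p, of "z + of_int c * w" "Suc m"] unfolding c
      by (simp only: mult_minus_left add.assoc left_minus add_0_right)
  qed
  show ?thesis
    using i[OF t, of "z + of_int a" b] i[OF 1, of z a] by simp
qed

lemma doubly_periodic_entire_constant:
  assumes hol: "f holomorphic_on UNIV"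
    and 1: "\<And>z. f (z + 1) = f z" and t: "\<And>z. f (z + \<tau>) = f z"
  shows "f constant_on UNIV"
proof (rule Liouville_theorem[OF hol])
  define K where "K = (\<lambda>(s, t). of_real s + of_real t * \<tau>) ` ({0..1} \<times> {0..1})"
  have "compact K"
    unfolding K_def by (intro compact_continuous_image compact_Times)
      (auto intro!: continuous_intros simp: case_prod_unfold)
  have "range f \<subseteq> f ` K"
  proof
    fix y assume "y \<in> range f"
    then obtain z where z: "y = f z" by auto
    \<comment> \<open>\<open>s\<close> and \<open>t\<close> are the real coordinates of
      \<open>z\<close> in the basis 1, \<tau>; their fractional parts give a representative in the
      period parallelogram \<open>K\<close>.\<close>
    define t where "t = Im z / Im \<tau>"
    define s where "s = Re z - t * Re \<tau>"
    have zz: "z = of_real s + of_real t * \<tau>"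
      using Im_tau by (simp add: complex_eq_iff s_def t_def)
    let ?w = "of_real (frac s) + of_real (frac t) * \<tau>"
    have "z = ?w + of_int \<lfloor>s\<rfloor> + of_int \<lfloor>t\<rfloor> * \<tau>"
      unfolding zz frac_def by (simp add: algebra_simps)
    then have "f z = f ?w"
      using doubly_periodic_shift[of f, OF 1 assms(3)] by metis
    moreover have "?w \<in> K"
      unfolding K_def by (rule image_eqI[of _ _ "(frac s, frac t)"])
        (auto simp: less_imp_le frac_lt_1)
    ultimately show "y \<in> f ` K"
      using z by auto
  qed
  moreover have "bounded (f ` K)"
    using \<open>compact K\<close> hol
    by (meson compact_continuous_image compact_imp_bounded continuous_on_subset
        holomorphic_on_imp_continuous_on subset_UNIV)
  ultimately show "bounded (range f)"
    using bounded_subset by blast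
qed

lemma has_derivative_theta: "(theta \<tau> has_field_derivative deriv (theta \<tau>) x) (at x)"
  using holomorphic_derivI[OF holomorphic_theta[OF holomorphic_on_ident, of UNIV], of x] by simp

text \<open>Simplicity of the zero at 0 is carried over the lattice by oddness and the two
  quasi-periods: differentiating theta (x + w) = e(x) theta (x) at a zero l leaves only e(l) times
  the derivative of theta at l.\<close>

lemma deriv_theta_lattice:
  assumes "theta \<tau> x = 0"
  shows "deriv (theta \<tau>) x \<noteq> 0"
proof -
  define Q where "Q l \<longleftrightarrow> theta \<tau> l = 0 \<and> deriv (theta \<tau>) l \<noteq> 0" for l
  have neg: "Q (- l)" if "Q l" for l
  proof -
    have "((\<lambda>x. - theta \<tau> (- x)) has_field_derivative deriv (theta \<tau>) l) (at (- l))"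
      using DERIV_minus[OF DERIV_chain'[of uminus "-1" "- l" UNIV "theta \<tau>" "deriv (theta \<tau>) l"]]
        has_derivative_theta[of l] DERIV_minus[OF DERIV_ident, of "- l"]
      by simp
    then have "(theta \<tau> has_field_derivative deriv (theta \<tau>) l) (at (- l))"
      by (simp add: theta_minus)
    from DERIV_imp_deriv[OF this] that show ?thesis
      by (simp add: Q_def theta_minus)
  qed
  have mult: "Q (l + w)" if "Q l" and e: "e holomorphic_on UNIV" "e l \<noteq> 0"
    and eq: "\<And>x. theta \<tau> (x + w) = e x * theta \<tau> x" for l w e
  proof -
    have "(e has_field_derivative deriv e l) (at l)"
      using holomorphic_derivI[OF e(1), of l] by simp
    from DERIV_mult[OF this has_derivative_theta[of l]]
    have "((\<lambda>x. theta \<tau> (x + w)) has_field_derivative e l * deriv (theta \<tau>) l) (at l)"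
      using \<open>Q l\<close> by (simp add: eq Q_def mult.commute)
    then have "(theta \<tau> has_field_derivative e l * deriv (theta \<tau>) l) (at (l + w))"
      by (simp add: DERIV_shift)
    from DERIV_imp_deriv[OF this] that show ?thesis
      by (simp add: Q_def)
  qed
  have one: "Q (l + 1)" if "Q l" for l
    using that by (rule mult[of l "\<lambda>_. -1"]) (auto simp: theta_plus_1)
  have tau: "Q (l + \<tau>)" if "Q l" for l
    using that by (rule mult[OF _ _ _ theta_plus_tau]) (auto intro!: holomorphic_intros)
  have nat: "Q (of_nat m)" for m
  proof (induction m)
    case 0
    then show ?case using deriv_theta_0 by (simp add: Q_def)
  next
    case (Suc m)
    then show ?case using one[of "of_nat m"] by (simp add: add.commute)
  qed
  have int: "Q (of_int a)" for a
    using nat neg[OF nat] by (cases a rule: int_cases2) auto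
  have nat_tau: "Q (of_int a + of_nat m * \<tau>)" for a m
  proof (induction m)
    case 0
    then show ?case using int by simp
  next
    case (Suc m)
    then show ?case using tau[of "of_int a + of_nat m * \<tau>"] by (simp add: algebra_simps)
  qed
  obtain a b where x: "x = of_int a + of_int b * \<tau>"
    using assms unfolding theta_eq_0_iff period_lattice_def by auto
  have "Q x"
    using nat_tau[of a] neg[OF nat_tau[of "- a"]]
    unfolding x by (cases b rule: int_cases2) auto
  then show ?thesis by (simp add: Q_def)
qed

lemma eventually_theta_neq_0: "eventually (\<lambda>x. theta \<tau> x \<noteq> 0) (at z)"
proof (cases "theta \<tau> z = 0")
  case True
  have "((\<lambda>x. (theta \<tau> x - theta \<tau> z) / (x - z)) \<longlongrightarrow> deriv (theta \<tau>) z) (at z)"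
    using has_derivative_theta[of z] by (simp add: has_field_derivative_iff)
  then have "eventually (\<lambda>x. (theta \<tau> x - theta \<tau> z) / (x - z) \<noteq> 0) (at z)"
    by (rule tendsto_imp_eventually_ne) (rule deriv_theta_lattice[OF True])
  then show ?thesis
    by eventually_elim (use True in auto)
next
  case False
  then show ?thesis
    using isCont_theta[of z] unfolding isCont_def by (rule tendsto_imp_eventually_ne[rotated])
qed

lemma eventually_theta_shift_neq_0: "eventually (\<lambda>x. theta \<tau> (x + c) \<noteq> 0) (at z)"
  using eventually_theta_neq_0[of "z + c"] at_to_0[of "z + c"] at_to_0[of z]
  by (simp add: eventually_filtermap add_ac)

lemma tendsto_theta [tendsto_intros]:
  "(f \<longlongrightarrow> a) A \<Longrightarrow> ((\<lambda>x. theta \<tau> (f x)) \<longlongrightarrow> theta \<tau> a) A"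
  by (rule isCont_tendsto_compose[OF isCont_theta])

text \<open>Up to a factor g(x) g(y) this is a difference of two values of the Weierstrass
  p-function, which accounts for its antisymmetry and for the three-term relation.\<close>

definition tt :: "complex \<Rightarrow> complex \<Rightarrow> complex" where
  "tt x y = theta \<tau> (x + y) * theta \<tau> (x - y)"

lemma tt_swap: "tt y x = - tt x y"
  using theta_minus[of "x - y"] by (simp add: tt_def add.commute)

lemma tt_minus: "tt (- x) y = tt x y"
  using theta_minus[of "x - y"] theta_minus[of "x + y"] by (simp add: tt_def algebra_simps)

lemma tt_plus_1: "tt (x + 1) y = tt x y"
  using theta_plus_1[of "x + y"] theta_plus_1[of "x - y"] by (simp add: tt_def algebra_simps)

lemma tt_plus_tau: "tt (x + \<tau>) y = exp (- (of_real pi * \<i> * (4 * x + 2 * \<tau>))) * tt x y"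
proof -
  have e: "x + \<tau> + y = (x + y) + \<tau>" "x + \<tau> - y = (x - y) + \<tau>"
    by simp_all
  have "exp (- (of_real pi * \<i> * (4 * x + 2 * \<tau>))) =
      exp (- (of_real pi * \<i> * (2 * (x + y) + \<tau>))) * exp (- (of_real pi * \<i> * (2 * (x - y) + \<tau>)))"
    unfolding exp_add[symmetric] by (simp add: algebra_simps)
  then show ?thesis
    unfolding tt_def e theta_plus_tau by simp
qed

text \<open>
  As functions of \<open>x\<close>, all the products \<open>tt x _\<close> have the same multipliers, so the quotient of a
  combination vanishing at \<open>\<plusminus> z\<close> by \<open>tt x z\<close> is an elliptic function without poles.
\<close>

lemma weierstrass_generic:
  assumes z: "theta \<tau> (2 * z) \<noteq> 0" and wz: "tt w z \<noteq> 0"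
  shows "tt x y * tt z w + tt x z * tt w y + tt x w * tt y z = 0"
proof -
  define N where "N x = tt x y * tt z w + tt x w * tt y z" for x
  define D where "D x = tt x z" for x
  have holtt: "(\<lambda>x. tt x y) holomorphic_on UNIV" for y
    unfolding tt_def by (intro holomorphic_intros)
  have N: "N holomorphic_on UNIV" and D: "D holomorphic_on UNIV"
    unfolding N_def D_def by (intro holomorphic_intros holtt)+
  define e where "e x = exp (- (of_real pi * \<i> * (4 * x + 2 * \<tau>)))" for x :: complex
  have e0: "e x \<noteq> 0" for x by (simp add: e_def)
  have per1: "N (x + 1) = N x" "D (x + 1) = D x" for x
    by (simp_all add: N_def D_def tt_plus_1)
  have pert: "N (x + \<tau>) = e x * N x" "D (x + \<tau>) = e x * D x" for x
    unfolding N_def D_def tt_plus_tau e_def[symmetric] by (simp_all only: distrib_left mult_ac)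
  have Dd: "deriv D x = deriv (theta \<tau>) (x + z) * theta \<tau> (x - z) + theta \<tau> (x + z) *
      deriv (theta \<tau>) (x - z)" for x
  proof (rule DERIV_imp_deriv)
    show "(D has_field_derivative
      deriv (theta \<tau>) (x + z) * theta \<tau> (x - z) + theta \<tau> (x + z) * deriv (theta \<tau>) (x - z)) (at x)"
      unfolding D_def[abs_def] tt_def
      using DERIV_mult[of "\<lambda>x. theta \<tau> (x + z)" "deriv (theta \<tau>) (x + z)" x UNIV
          "\<lambda>x. theta \<tau> (x - z)" "deriv (theta \<tau>) (x - z)"]
        has_derivative_theta[of "x + z"] has_derivative_theta[of "x - z"]
        DERIV_shift[of "theta \<tau>" _ x z] DERIV_shift[of "theta \<tau>" _ x "- z"]
      by (simp add: mult.commute)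
  qed
  have lat: "x + y \<in> period_lattice \<tau>" if "x \<in> period_lattice \<tau>" "y \<in> period_lattice \<tau>" for x y
  proof -
    obtain a b c d where "x = of_int a + of_int b * \<tau>" "y = of_int c + of_int d * \<tau>"
      using \<open>x \<in> _\<close> \<open>y \<in> _\<close> unfolding period_lattice_def by blast
    then have "x + y = of_int (a + c) + of_int (b + d) * \<tau>" by (simp add: algebra_simps)
    then show ?thesis unfolding period_lattice_def by blast
  qed
  \<comment> \<open>If both factors of \<open>D\<close> vanished at \<open>x\<close>, the difference
    2 z of their arguments would be a period, against the hypothesis on \<open>z\<close>. This is
    what makes the zeros of \<open>D\<close> simple.\<close>
  have D0: "theta \<tau> (x - z) = 0 \<and> theta \<tau> (x + z) \<noteq> 0 \<or> theta \<tau> (x + z) = 0 \<and> theta \<tau> (x - z) \<noteq> 0"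
    if "D x = 0" for x
  proof -
    have "\<not> (theta \<tau> (x - z) = 0 \<and> theta \<tau> (x + z) = 0)"
      using lat[of "x + z" "- (x - z)"] z period_lattice_uminus[of "x - z"]
          unfolding theta_eq_0_iff by auto
    then show ?thesis
      using that by (auto simp: D_def tt_def)
  qed
  have simple: "deriv D x \<noteq> 0" if "D x = 0" for x
    using D0[OF that] deriv_theta_lattice unfolding Dd by auto
  \<comment> \<open>Antisymmetry of \<open>tt\<close> yields the zero of \<open>N\<close> at z,
    evenness the one at -z. The multipliers never vanish, so both spread to all lattice translates,
    and these exhaust the zeros of \<open>D\<close>.\<close>
  have Nz: "N z = 0"
    using tt_swap[of y z] by (simp add: N_def algebra_simps)
  have Nmz: "N (- z) = 0"
    using Nz by (simp add: N_def tt_minus)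
  have Nl: "N (x + l) = 0" if "N x = 0" "l \<in> period_lattice \<tau>" for x l
  proof -
    obtain a b where l: "l = of_int a + of_int b * \<tau>"
      using \<open>l \<in> _\<close> unfolding period_lattice_def by blast
    show ?thesis
      using doubly_periodic_shift[of "\<lambda>x. N x = 0" x a b] that per1 pert e0
          by (simp add: l algebra_simps)
  qed
  have zero: "N x = 0" if "D x = 0" for x
    using D0[OF that] Nl[OF Nz, of "x - z"] Nl[OF Nmz, of "x + z"] by (auto simp: theta_eq_0_iff)
  obtain G where G: "G holomorphic_on UNIV" "\<And>z. N z = G z * D z" "\<And>z. D z \<noteq> 0 \<Longrightarrow> G z = N z / D z"
    using entire_quotient[OF N D zero simple] by metis
  have isolated: "eventually (\<lambda>x. D x \<noteq> 0) (at x)" for x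
  proof -
    from eventually_theta_shift_neq_0[of z x] eventually_theta_shift_neq_0[of "- z" x] show ?thesis
      by eventually_elim (simp add: D_def tt_def)
  qed
  \<comment> \<open>The multipliers cancel in the quotient away from the zeros of \<open>D\<close>;
    these are isolated, so continuity of \<open>G\<close> gives the rest.\<close>
  have per: "G (x + p) = G x" if p: "\<And>x. N (x + p) = c x * N x" "\<And>x. D (x + p) =
      c x * D x" "\<And>x. c x \<noteq> 0"
    for c p x
  proof -
    have "isCont G x" for x
      using holomorphic_on_imp_continuous_on[OF G(1)] by (simp add: continuous_on_eq_continuous_at)
    then have "((\<lambda>x. G (x + p) - G x) \<longlongrightarrow> G (x + p) - G x) (at x)"
      by (intro tendsto_intros isCont_tendsto_compose[of _ G]) (auto simp: isCont_def)
    moreover have "eventually (\<lambda>x. G (x + p) - G x = 0) (at x)"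
      using isolated[of x]
    proof eventually_elim
      case (elim x)
      then have "D (x + p) \<noteq> 0" using p by simp
      then show ?case using elim p by (simp add: G(3))
    qed
    then have "((\<lambda>x. G (x + p) - G x) \<longlongrightarrow> 0) (at x)"
      by (simp add: tendsto_eventually)
    ultimately show ?thesis
      using tendsto_unique[OF trivial_limit_at] by fastforce
  qed
  have "G constant_on UNIV"
    using doubly_periodic_entire_constant[OF G(1)] per[of 1 "\<lambda>_. 1"] per[of \<tau> e]
        per1 pert e0 by simp
  then obtain c where c: "\<And>x. G x = c"
    unfolding constant_on_def by blast
  \<comment> \<open>At x = w the term with \<open>tt w w\<close> drops out, which identifies the
    constant value of \<open>G\<close>.\<close>
  have "N w = - tt w y * D w"
    using tt_swap[of w z] by (simp add: N_def D_def tt_def)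
  then have "c * tt w z = (- tt w y) * tt w z"
    using G(2)[of w] by (simp add: c D_def)
  then have "c = - tt w y"
    unfolding mult_right_cancel[OF wz] .
  then have "N x = - tt w y * D x"
    using G(2)[of x] c by simp
  then show ?thesis
    by (simp add: N_def D_def algebra_simps)
qed

text \<open>The values of \<open>z\<close> excluded in \<open>weierstrass_generic\<close> are
  isolated and the left side is continuous in \<open>z\<close>, so the identity extends to all
  \<open>z\<close>.\<close>

theorem weierstrass: "tt x y * tt z w + tt x z * tt w y + tt x w * tt y z = 0"
proof -
  let ?Z = "\<lambda>z. tt x y * tt z w + tt x z * tt w y + tt x w * tt y z"
  have "filterlim (\<lambda>z. 2 * z) (at (2 * z)) (at z)"
    by (rule filterlim_atI) (auto intro!: tendsto_intros simp: eventually_at_filter)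
  then have "eventually (\<lambda>z. theta \<tau> (2 * z) \<noteq> 0) (at z)"
    using eventually_theta_neq_0 by (rule eventually_compose_filterlim[rotated])
  then have "eventually (\<lambda>z. ?Z z = 0) (at z)"
    using eventually_theta_shift_neq_0[of w z] eventually_theta_shift_neq_0[of "- w" z]
  proof eventually_elim
    case (elim z)
    then have "tt w z \<noteq> 0"
      using tt_swap[of w z] by (simp add: tt_def)
    with elim show ?case
      by (intro weierstrass_generic) auto
  qed
  then have "(?Z \<longlongrightarrow> 0) (at z)"
    by (simp add: tendsto_eventually)
  moreover have "(?Z \<longlongrightarrow> ?Z z) (at z)"
    unfolding tt_def by (intro tendsto_intros)
  ultimately show ?thesis
    using tendsto_unique[OF trivial_limit_at] by fastforce
qed


section \<open>The normalized theta function and the exchange of two crossings\<close>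

abbreviation V :: "complex \<Rightarrow> complex" where
  "V \<equiv> vtheta \<tau>"

lemma vtheta_eq_0_iff: "V x = 0 \<longleftrightarrow> x \<in> period_lattice \<tau>"
  using deriv_theta_0 theta_eq_0_iff by (simp add: vtheta_def)

lemma vtheta_minus: "V (- x) = - V x"
  by (simp add: vtheta_def theta_minus)

lemma vtheta_0 [simp]: "V 0 = 0"
  by (simp add: vtheta_def)

lemma tendsto_vtheta [tendsto_intros]:
  "(f \<longlongrightarrow> a) A \<Longrightarrow> ((\<lambda>x. V (f x)) \<longlongrightarrow> V a) A"
  unfolding vtheta_def by (rule tendsto_divide[OF tendsto_theta tendsto_const deriv_theta_0])

lemma vtheta_weierstrass:
  assumes "p + q = r + s"
  shows "V (p + h) * V (q + h) * V r * V s - V (r + h) * V (s + h) * V p * V q =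
    - (V (p + q + h) * V h * V (r - q) * V (r - p))"
proof -
  \<comment> \<open>Half sums and half differences turn each product of four values into two values
    of \<open>tt\<close>; the hypothesis on p, q, r, s is what makes \<open>?Z + ?W\<close> and
    \<open>?Z - ?W\<close> equal to r and s.\<close>
  let ?X = "(p + q) / 2 + h" and ?Y = "(p - q) / 2" and ?Z = "(p + q) / 2" and ?W = "(r - s) / 2"
  have s: "s = p + q - r"
    using assms by (simp add: algebra_simps)
  have e: "?X + ?Y = p + h" "?X - ?Y = q + h" "?Z + ?W = r" "?Z - ?W = s" "?X + ?Z = p + q + h"
    "?X - ?Z = h" "?W + ?Y = r - q" "?W - ?Y = r - p" "?X + ?W = r + h" "?X - ?W = s + h"
    "?Y + ?Z = p" "?Y - ?Z = - q"
    unfolding s by (simp_all add: field_simps)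
  have "theta \<tau> (p + h) * theta \<tau> (q + h) * (theta \<tau> r * theta \<tau> s) +
      theta \<tau> (p + q + h) * theta \<tau> h * (theta \<tau> (r - q) * theta \<tau> (r - p)) +
      theta \<tau> (r + h) * theta \<tau> (s + h) * (theta \<tau> p * (- theta \<tau> q)) = 0"
    using weierstrass[of ?X ?Y ?Z ?W] unfolding tt_def e theta_minus .
  then have "theta \<tau> (p + h) * theta \<tau> (q + h) * theta \<tau> r * theta \<tau> s -
      theta \<tau> (r + h) * theta \<tau> (s + h) * theta \<tau> p * theta \<tau> q =
      - (theta \<tau> (p + q + h) * theta \<tau> h * theta \<tau> (r - q) * theta \<tau> (r - p))"
    by (simp add: algebra_simps add_eq_0_iff)
  then show ?thesis
    unfolding vtheta_def
    by (simp only: times_divide_times_eq diff_divide_distrib[symmetric] minus_divide_left)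
qed

text \<open>
  The two sides are the two ways of crossing arrows \<open>i\<close> and \<open>i + 1\<close> of the minimal pattern (at their
  targets \<open>a, b\<close>, or at their sources \<open>c, d\<close> followed by an exchange of the labels).
\<close>

lemma exchange_identity:
  assumes nz: "V (b - a) \<noteq> 0" "V (\<alpha> - \<beta>) \<noteq> 0" "V (a - c) \<noteq> 0" "V (b - d) \<noteq> 0" "V \<alpha> \<noteq> 0"
    "V \<beta> \<noteq> 0" "V (a - d) \<noteq> 0" "V (b - c) \<noteq> 0" "V (d - c) \<noteq> 0" "V h \<noteq> 0"
  shows "F \<tau> (b - a) (\<alpha> - \<beta>) * (F \<tau> (a - c) \<alpha> * F \<tau> (b - d) \<beta> * F \<tau> (a - d) h) +
      F \<tau> (a - b) h * (F \<tau> (b - c) \<alpha> * F \<tau> (a - d) \<beta> * F \<tau> (b - d) h) =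
    F \<tau> (d - c) (\<alpha> - \<beta>) * (F \<tau> (a - c) \<beta> * F \<tau> (b - d) \<alpha> * F \<tau> (a - d) h) +
      F \<tau> (c - d) h * (F \<tau> (a - d) \<beta> * F \<tau> (b - c) \<alpha> * F \<tau> (a - c) h)"
proof -
  \<comment> \<open>Two instances of the three-term identity follow, \<open>W1\<close> with shift
    \<alpha> - \<beta> and \<open>W2\<close> with shift h. Both produce this factor, which therefore
    matches at the end.\<close>
  let ?K = "V (a + d - b - c)"
  have m: "V (a - b) = - V (b - a)" "V (c - d) = - V (d - c)" "V (c - b) = - V (b - c)"
      "V (d - a - \<beta>) = - V (a - d + \<beta>)"
    using vtheta_minus[of "b - a"] vtheta_minus[of "d - c"] vtheta_minus[of "b - c"]
      vtheta_minus[of "a - d + \<beta>"] by (simp_all add: algebra_simps)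
  have "V (b - a + (\<alpha> - \<beta>)) * V (a - c + \<beta> + (\<alpha> - \<beta>)) * V (d - c) * V (b - d + \<beta>) -
      V (d - c + (\<alpha> - \<beta>)) * V (b - d + \<beta> + (\<alpha> - \<beta>)) * V (b - a) * V (a - c + \<beta>) =
      - (V (b - a + (a - c + \<beta>) + (\<alpha> - \<beta>)) * V (\<alpha> - \<beta>) * V (d - c - (a - c + \<beta>)) * V (d - c - (b - a)))"
    by (rule vtheta_weierstrass) simp
  moreover have "a - c + \<beta> + (\<alpha> - \<beta>) = a - c + \<alpha>" "b - d + \<beta> + (\<alpha> - \<beta>) = b - d + \<alpha>"
    "b - a + (a - c + \<beta>) + (\<alpha> - \<beta>) = b - c + \<alpha>" "d - c - (a - c + \<beta>) = d - a - \<beta>"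
    "d - c - (b - a) = a + d - b - c"
    by (simp_all add: algebra_simps)
  ultimately have W1: "V (b - a + (\<alpha> - \<beta>)) * V (a - c + \<alpha>) * V (d - c) * V (b - d + \<beta>) -
      V (d - c + (\<alpha> - \<beta>)) * V (b - d + \<alpha>) * V (b - a) * V (a - c + \<beta>) =
      V (b - c + \<alpha>) * V (\<alpha> - \<beta>) * V (a - d + \<beta>) * ?K"
    by (simp only: m mult_minus_left mult_minus_right minus_minus)
  have "V (c - d + h) * V (a - c + h) * V (a - b) * V (b - d) -
      V (a - b + h) * V (b - d + h) * V (c - d) * V (a - c) =
      - (V (c - d + (a - c) + h) * V h * V (a - b - (a - c)) * V (a - b - (c - d)))"
    by (rule vtheta_weierstrass) simp
  moreover have "c - d + (a - c) + h = a - d + h" "a - b - (a - c) = c - b"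
    "a - b - (c - d) = a + d - b - c"
    by (simp_all add: algebra_simps)
  ultimately have W2: "- V (c - d + h) * V (a - c + h) * V (b - a) * V (b - d) +
      V (a - b + h) * V (b - d + h) * V (d - c) * V (a - c) =
      V (a - d + h) * V h * V (b - c) * ?K"
    by (simp only: m mult_minus_left mult_minus_right minus_minus diff_minus_eq_add)
  have "F \<tau> (b - a) (\<alpha> - \<beta>) * F \<tau> (a - c) \<alpha> * F \<tau> (b - d) \<beta> -
      F \<tau> (d - c) (\<alpha> - \<beta>) * F \<tau> (a - c) \<beta> * F \<tau> (b - d) \<alpha> =
    (V (b - a + (\<alpha> - \<beta>)) * V (a - c + \<alpha>) * V (d - c) * V (b - d + \<beta>) -
      V (d - c + (\<alpha> - \<beta>)) * V (b - d + \<alpha>) * V (b - a) * V (a - c + \<beta>)) /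
    (V (b - a) * V (d - c) * V (\<alpha> - \<beta>) * V (a - c) * V (b - d) * V \<alpha> * V \<beta>)"
    unfolding F_eq_vtheta using nz by (simp add: divide_simps)
  also have "\<dots> = V (b - c + \<alpha>) * V (a - d + \<beta>) * ?K /
      (V (b - a) * V (d - c) * V (a - c) * V (b - d) * V \<alpha> * V \<beta>)"
    unfolding W1 using nz by (simp add: divide_simps)
  finally have L: "F \<tau> (b - a) (\<alpha> - \<beta>) * F \<tau> (a - c) \<alpha> * F \<tau> (b - d) \<beta> -
      F \<tau> (d - c) (\<alpha> - \<beta>) * F \<tau> (a - c) \<beta> * F \<tau> (b - d) \<alpha> = \<dots>" .
  have "F \<tau> (c - d) h * F \<tau> (a - c) h - F \<tau> (a - b) h * F \<tau> (b - d) h =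
     (- V (c - d + h) * V (a - c + h) * V (b - a) * V (b - d) +
      V (a - b + h) * V (b - d + h) * V (d - c) * V (a - c)) /
     (V h * V h * V (d - c) * V (a - c) * V (b - a) * V (b - d))"
    unfolding F_eq_vtheta m using nz by (simp add: divide_simps)
  also have "\<dots> = V (a - d + h) * V (b - c) * ?K /
     (V h * V (d - c) * V (a - c) * V (b - a) * V (b - d))"
    unfolding W2 using nz by (simp add: divide_simps)
  finally have R: "F \<tau> (c - d) h * F \<tau> (a - c) h - F \<tau> (a - b) h * F \<tau> (b - d) h = \<dots>" .
  \<comment> \<open>The first terms of the two sides share the factor at a - d with h, the second
    terms share those at b - c with \<alpha> and at a - d with \<beta>. Collecting like terms leaves
    exactly the differences \<open>L\<close> and \<open>R\<close>.\<close>
  have "F \<tau> (a - d) h * (F \<tau> (b - a) (\<alpha> - \<beta>) * F \<tau> (a - c) \<alpha> * F \<tau> (b - d) \<beta> -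
      F \<tau> (d - c) (\<alpha> - \<beta>) * F \<tau> (a - c) \<beta> * F \<tau> (b - d) \<alpha>) =
    F \<tau> (b - c) \<alpha> * F \<tau> (a - d) \<beta> *
      (F \<tau> (c - d) h * F \<tau> (a - c) h - F \<tau> (a - b) h * F \<tau> (b - d) h)"
    unfolding L R unfolding F_eq_vtheta using nz by (simp add: divide_simps)
  then show ?thesis
    by (simp add: algebra_simps)
qed

end

section \<open>Words and their values\<close>

lemma word_perm_Nil [simp]: "word_perm [] = id"
  by (simp add: word_perm_def)

lemma word_perm_Cons [simp]: "word_perm (i # js) = sw i \<circ> word_perm js"
  by (simp add: word_perm_def)

lemma word_perm_append [simp]: "word_perm (js @ ks) = word_perm js \<circ> word_perm ks"
  by (induction js) (auto simp: o_assoc)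

lemma bij_word_perm [simp, intro]: "bij (word_perm js)"
proof (induction js)
  case (Cons i js)
  then show ?case
    unfolding word_perm_Cons by (rule bij_comp) simp
qed (simp only: word_perm_Nil bij_id)

lemma word_perm_permutes:
  assumes "\<And>i. i \<in> set js \<Longrightarrow> {i, Suc i} \<subseteq> A"
  shows "word_perm js permutes A"
  using assms
proof (induction js)
  case (Cons i js)
  then show ?case
    unfolding word_perm_Cons by (intro permutes_compose permutes_swap_id) auto
qed (simp add: permutes_id)

lemma inv_sw_comp: "bij w \<Longrightarrow> inv (sw i \<circ> w) = inv w \<circ> sw i"
  by (subst o_inv_distrib) auto

lemma inv_word_perm_append_single:
  "inv (word_perm (js @ [i])) k = sw i (inv (word_perm js) k)"
  by (simp add: o_inv_distrib[OF bij_word_perm])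

text \<open>Arrow i contributes (x_i - x_{n+i}) \<mu>_i to the type of the minimal class, so a
  source node carries its label with a minus sign. One function for both blocks gives one formula
  for the parameters of target and source crossings.\<close>

definition signed :: "nat \<Rightarrow> (nat \<Rightarrow> complex) \<Rightarrow> nat \<Rightarrow> complex" where
  "signed n \<mu> k = (if k \<le> n then \<mu> k else - \<mu> (k - n))"

lemma sw_add: "sw (n + i) (n + k) = n + sw i k"
  by (cases "k = i"; cases "k = Suc i") (auto simp: Transposition.transpose_def)

lemma sw_less: "k < i \<Longrightarrow> sw i k = k"
  by (simp add: Transposition.transpose_def)

text \<open>Relabelling by s_i amounts to exchanging the targets i, i + 1 and the sources n + i, n +
  i + 1 together. Hence exchanging the sources alone is the same as exchanging the targets and
  relabelling.\<close>

lemma signed_sw: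
  assumes "1 \<le> i" "i < n"
  shows "signed n \<mu> (sw (n + i) p) = signed n (\<mu> \<circ> sw i) (sw i p)"
  using assms by (auto simp: signed_def Transposition.transpose_def)

definition pairs :: "nat \<Rightarrow> (nat \<times> nat) set" where
  "pairs n = {(i, j). 1 \<le> i \<and> i < j \<and> j \<le> n}"

lemma finite_pairs [simp]: "finite (pairs n)"
  by (rule finite_subset[of _ "{1..n} \<times> {1..n}"]) (auto simp: pairs_def)

text \<open>When s_i acts on a single coordinate, (i, i + 1) is the only pair that stops being
  increasing. The first coordinate will stand for targets, the second for sources.\<close>

lemma bij_betw_pairs:
  assumes "1 \<le> i" "i < n"
  defines "P \<equiv> pairs n - {(i, Suc i)}"
  shows "bij_betw (map_prod (sw i) id) P P" "bij_betw (map_prod id (sw i)) P P"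
proof -
  have *: "map_prod (sw i) id p \<in> P \<and> map_prod id (sw i) p \<in> P" if "p \<in> P" for p
  proof -
    obtain k l where "p = (k, l)" "1 \<le> k" "k < l" "l \<le> n" "k \<noteq> i \<or> l \<noteq> Suc i"
      using \<open>p \<in> P\<close> by (cases p) (auto simp: P_def pairs_def)
    then show ?thesis
      using assms by (auto simp: pairs_def Transposition.transpose_def)
  qed
  then show "bij_betw (map_prod (sw i) id) P P"
    by (intro bij_betw_byWitness[where f' = "map_prod (sw i) id"]) auto
  show "bij_betw (map_prod id (sw i)) P P"
    using * by (intro bij_betw_byWitness[where f' = "map_prod id (sw i)"]) auto
qed

section \<open>Values along words, and the elimination of source crossings\<close>

locale elliptic = upper_half +
  fixes h :: complex and n :: nat
begin

text \<open>For words without the letter n this is the value of a \<open>word_class\<close>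
  expression at generic points with trivial u, the admissible parameter being written out; see
  \<open>word_class_val\<close>. Crossings are exchanged here and not on expressions, where the two
  sides are formally different.\<close>

primrec wval :: "nat list \<Rightarrow> (nat \<Rightarrow> complex) \<Rightarrow> (nat \<Rightarrow> complex) \<Rightarrow> complex" where
  "wval [] x \<mu> =
     (\<Prod>i=1..n. F \<tau> (x i - x (n + i)) (\<mu> i)) * (\<Prod>(i, j)\<in>pairs n. F \<tau> (x i - x (n + j)) h)"
| "wval (i # js) x \<mu> =
     F \<tau> (x (Suc i) - x i)
       (signed n \<mu> (inv (word_perm js) i) - signed n \<mu> (inv (word_perm js) (Suc i))) * wval js x \<mu> +
     F \<tau> (x i - x (Suc i)) h * wval js (x \<circ> sw i) \<mu>"

definition gen_x :: "(nat \<Rightarrow> complex) \<Rightarrow> bool" where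
  "gen_x x \<longleftrightarrow> (\<forall>i\<in>{1..2*n}. \<forall>j\<in>{1..2*n}. i \<noteq> j \<longrightarrow> V (x i - x j) \<noteq> 0)"

definition gen_mu :: "(nat \<Rightarrow> complex) \<Rightarrow> bool" where
  "gen_mu \<mu> \<longleftrightarrow> V h \<noteq> 0 \<and> (\<forall>i\<in>{1..n}. V (\<mu> i) \<noteq> 0) \<and>
     (\<forall>i\<in>{1..n}. \<forall>j\<in>{1..n}. i \<noteq> j \<longrightarrow> V (\<mu> i - \<mu> j) \<noteq> 0)"

lemma gen_x_comp:
  assumes "gen_x x" "w permutes {1..2*n}"
  shows "gen_x (x \<circ> w)"
  unfolding gen_x_def
proof (intro ballI impI)
  fix i j assume "i \<in> {1..2*n}" "j \<in> {1..2*n}" "i \<noteq> j"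
  then have "w i \<in> {1..2*n}" "w j \<in> {1..2*n}" "w i \<noteq> w j"
    using permutes_in_image[OF assms(2)] permutes_inj[OF assms(2)] by (auto dest: injD)
  then show "V ((x \<circ> w) i - (x \<circ> w) j) \<noteq> 0"
    using assms(1) by (simp add: gen_x_def)
qed

lemma gen_mu_comp:
  assumes "gen_mu \<mu>" "w permutes {1..n}"
  shows "gen_mu (\<mu> \<circ> w)"
proof -
  have "w i \<in> {1..n}" "i \<noteq> j \<Longrightarrow> w i \<noteq> w j" if "i \<in> {1..n}" for i j
    using permutes_in_image[OF assms(2)] permutes_inj[OF assms(2)] that by (auto dest: injD)
  then show ?thesis
    using assms(1) unfolding gen_mu_def by (simp del: atLeastAtMost_iff)
qed

lemma sw_permutes: "{i, Suc i} \<subseteq> A \<Longrightarrow> sw i permutes A"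
  by (rule permutes_swap_id) auto

text \<open>A prefix sees its suffix through the values and, in the parameters, through the
  permutation of the suffix.\<close>

lemma wval_append_cong:
  assumes "wval js = wval js'" "word_perm js = word_perm js'"
  shows "wval (ks @ js) = wval (ks @ js')"
proof (induction ks)
  case (Cons k ks)
  then show ?case
    by (intro ext) (simp add: assms(2))
qed (simp add: assms)

lemma wval_commute:
  assumes "Suc i < j"
  shows "wval (i # j # js) = wval (j # i # js)" "word_perm (i # j # js) = word_perm (j # i # js)"
proof -
  have c: "sw i \<circ> sw j = sw j \<circ> sw i"
    using assms by (auto simp: fun_eq_iff Transposition.transpose_def)
  then show "word_perm (i # j # js) = word_perm (j # i # js)"
    by (simp add: o_assoc)
  have s: "sw j i = i" "sw j (Suc i) = Suc i" "sw i j = j" "sw i (Suc j) = Suc j"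
    using assms by (simp_all add: Transposition.transpose_def)
  have x: "x \<circ> sw i \<circ> sw j = x \<circ> sw j \<circ> sw i" for x :: "nat \<Rightarrow> complex"
    using c by (metis comp_assoc)
  show "wval (i # j # js) = wval (j # i # js)"
    by (intro ext) (simp add: inv_sw_comp s x algebra_simps)
qed

lemma wval_move:
  assumes "\<And>k. k \<in> set ks \<Longrightarrow> Suc k < j"
  shows "wval (js @ j # ks) = wval (js @ ks @ [j])"
  using assms
proof (induction ks arbitrary: js)
  case (Cons k ks)
  have "wval (js @ j # k # ks) = wval (js @ k # j # ks)"
    using wval_commute[of k j ks] Cons.prems by (intro wval_append_cong) simp_all
  also have "\<dots> = wval ((js @ [k]) @ j # ks)" by simp
  also have "\<dots> = wval ((js @ [k]) @ ks @ [j])"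
    using Cons.prems by (intro Cons.IH) simp
  finally show ?case by simp
qed simp

text \<open>Isolates the three factors touched by the crossings of arrows i and i + 1. The cofactor
  \<open>R\<close> is unchanged by exchanging the targets, the sources or the labels, so it can be
  cancelled from both sides of the exchange.\<close>

lemma wval_Nil_split:
  assumes "1 \<le> i" "i < n"
  defines "R \<equiv> \<lambda>x \<mu>. (\<Prod>k\<in>{1..n} - {i, Suc i}. F \<tau> (x k - x (n + k)) (\<mu> k)) *
    (\<Prod>(k, l)\<in>pairs n - {(i, Suc i)}. F \<tau> (x k - x (n + l)) h)"
  shows "wval [] x \<mu> = R x \<mu> * (F \<tau> (x i - x (n + i)) (\<mu> i) *
      F \<tau> (x (Suc i) - x (n + Suc i)) (\<mu> (Suc i)) * F \<tau> (x i - x (n + Suc i)) h)"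
    and "R (x \<circ> sw i) \<mu> = R x \<mu>" "R (x \<circ> sw (n + i)) \<mu> = R x \<mu>" "R x (\<mu> \<circ> sw i) = R x \<mu>"
proof -
  have 1: "(\<Prod>k=1..n. f k) = (\<Prod>k\<in>{1..n} - {i, Suc i}. f k) *
      (f i * f (Suc i))" for f :: "nat \<Rightarrow> complex"
    using prod.subset_diff[of "{i, Suc i}" "{1..n}" f] assms by simp
  have 2: "(\<Prod>p\<in>pairs n. f p) = (\<Prod>p\<in>pairs n - {(i, Suc i)}. f p) *
      f (i, Suc i)" for f :: "nat \<times> nat \<Rightarrow> complex"
  proof -
    have "{(i, Suc i)} \<subseteq> pairs n"
      using assms by (simp add: pairs_def)
    then show ?thesis
      using prod.subset_diff[of "{(i, Suc i)}" "pairs n" f] by simp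
  qed
  show "wval [] x \<mu> = R x \<mu> * (F \<tau> (x i - x (n + i)) (\<mu> i) *
      F \<tau> (x (Suc i) - x (n + Suc i)) (\<mu> (Suc i)) * F \<tau> (x i - x (n + Suc i)) h)"
    unfolding wval.simps R_def 1 2 by (simp add: mult_ac)
  have s: "(\<Prod>k\<in>{1..n} - {i, Suc i}. F \<tau> ((x \<circ> sw i) k - (x \<circ> sw i) (n + k)) (\<mu> k)) =
     (\<Prod>k\<in>{1..n} - {i, Suc i}. F \<tau> (x k - x (n + k)) (\<mu> k))"
    "(\<Prod>k\<in>{1..n} - {i, Suc i}. F \<tau> ((x \<circ> sw (n + i)) k - (x \<circ> sw (n + i)) (n + k)) (\<mu> k)) =
     (\<Prod>k\<in>{1..n} - {i, Suc i}. F \<tau> (x k - x (n + k)) (\<mu> k))"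
    using assms by (auto intro!: prod.cong simp: Transposition.transpose_def)
  let ?P = "pairs n - {(i, Suc i)}"
  have "(\<Prod>(k, l)\<in>?P. F \<tau> ((x \<circ> sw i) k - (x \<circ> sw i) (n + l)) h) =
     (\<Prod>p\<in>?P. (\<lambda>(k, l). F \<tau> (x k - x (n + l)) h) (map_prod (sw i) id p))"
    by (rule prod.cong) (use assms in \<open>auto simp: pairs_def Transposition.transpose_def\<close>)
  also have "\<dots> = (\<Prod>(k, l)\<in>?P. F \<tau> (x k - x (n + l)) h)"
    by (rule prod.reindex_bij_betw) (rule bij_betw_pairs[OF assms(1,2)])
  finally show "R (x \<circ> sw i) \<mu> = R x \<mu>"
    using s by (simp add: R_def)
  have "(\<Prod>(k, l)\<in>?P. F \<tau> ((x \<circ> sw (n + i)) k - (x \<circ> sw (n + i)) (n + l)) h) =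
     (\<Prod>p\<in>?P. (\<lambda>(k, l). F \<tau> (x k - x (n + l)) h) (map_prod id (sw i) p))"
    by (rule prod.cong) (use assms in \<open>auto simp: pairs_def sw_add sw_less\<close>)
  also have "\<dots> = (\<Prod>(k, l)\<in>?P. F \<tau> (x k - x (n + l)) h)"
    by (rule prod.reindex_bij_betw) (rule bij_betw_pairs[OF assms(1,2)])
  finally show "R (x \<circ> sw (n + i)) \<mu> = R x \<mu>"
    using s by (simp add: R_def)
  have "(\<Prod>k\<in>{1..n} - {i, Suc i}. F \<tau> (x k - x (n + k)) ((\<mu> \<circ> sw i) k)) =
     (\<Prod>k\<in>{1..n} - {i, Suc i}. F \<tau> (x k - x (n + k)) (\<mu> k))"
    by (auto intro!: prod.cong simp: Transposition.transpose_def)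
  then show "R x (\<mu> \<circ> sw i) = R x \<mu>"
    by (simp add: R_def)
qed

lemma wval_exchange_single:
  assumes i: "1 \<le> i" "i < n" and x: "gen_x x" and \<mu>: "gen_mu \<mu>"
  shows "wval [n + i] x \<mu> = wval [i] x (\<mu> \<circ> sw i)"
proof -
  define R where "R x \<mu> = (\<Prod>k\<in>{1..n} - {i, Suc i}. F \<tau> (x k - x (n + k)) (\<mu> k)) *
    (\<Prod>(k, l)\<in>pairs n - {(i, Suc i)}. F \<tau> (x k - x (n + l)) h)" for x \<mu>
  note split = wval_Nil_split[OF i, folded R_def]
  let ?a = "x i" and ?b = "x (Suc i)" and ?c = "x (n + i)" and ?d = "x (n + Suc i)"
  let ?\<alpha> = "\<mu> (Suc i)" and ?\<beta> = "\<mu> i"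
  have sw: "sw i i = Suc i" "sw i (Suc i) = i" "sw i (n + i) = n + i" "sw i (n + Suc i) = n + Suc i"
    "sw (n + i) i = i" "sw (n + i) (Suc i) = Suc i" "sw (n + i) (n + i) = n + Suc i"
    "sw (n + i) (n + Suc i) = n + i"
    using i by (simp_all add: Transposition.transpose_def)
  \<comment> \<open>Sources carry their labels with a minus sign, and exchanging the labels also
    reverses their difference, so the two crossings have the same parameter.\<close>
  have sg: "signed n \<mu> (n + i) - signed n \<mu> (Suc (n + i)) = ?\<alpha> - ?\<beta>"
    "signed n (\<mu> \<circ> sw i) i - signed n (\<mu> \<circ> sw i) (Suc i) = ?\<alpha> - ?\<beta>"
    using i by (simp_all add: signed_def Suc_diff_le sw)
  have w: "wval [] x \<mu> = R x \<mu> * (F \<tau> (?a - ?c) ?\<beta> * F \<tau> (?b - ?d) ?\<alpha> * F \<tau> (?a - ?d) h)"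
    "wval [] (x \<circ> sw (n + i)) \<mu> = R x \<mu> * (F \<tau> (?a - ?d) ?\<beta> * F \<tau> (?b - ?c) ?\<alpha> * F \<tau> (?a - ?c) h)"
    "wval [] x (\<mu> \<circ> sw i) = R x \<mu> * (F \<tau> (?a - ?c) ?\<alpha> * F \<tau> (?b - ?d) ?\<beta> * F \<tau> (?a - ?d) h)"
    "wval [] (x \<circ> sw i) (\<mu> \<circ> sw i) =
        R x \<mu> * (F \<tau> (?b - ?c) ?\<alpha> * F \<tau> (?a - ?d) ?\<beta> * F \<tau> (?b - ?d) h)"
    unfolding split by (simp_all only: o_apply sw)
  have L: "wval [n + i] x \<mu> = F \<tau> (?d - ?c) (?\<alpha> - ?\<beta>) * wval [] x \<mu> + F \<tau> (?c - ?d) h *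
      wval [] (x \<circ> sw (n + i)) \<mu>"
    by (simp only: wval.simps(2) word_perm_Nil inv_id id_apply sg add_Suc_right)
  have Rr: "wval [i] x (\<mu> \<circ> sw i) = F \<tau> (?b - ?a) (?\<alpha> - ?\<beta>) * wval [] x (\<mu> \<circ> sw i) +
      F \<tau> (?a - ?b) h * wval [] (x \<circ> sw i) (\<mu> \<circ> sw i)"
    by (simp only: wval.simps(2) word_perm_Nil inv_id id_apply sg)
  have "F \<tau> (?b - ?a) (?\<alpha> - ?\<beta>) * (F \<tau> (?a - ?c) ?\<alpha> * F \<tau> (?b - ?d) ?\<beta> * F \<tau> (?a - ?d) h) +
      F \<tau> (?a - ?b) h * (F \<tau> (?b - ?c) ?\<alpha> * F \<tau> (?a - ?d) ?\<beta> * F \<tau> (?b - ?d) h) =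
    F \<tau> (?d - ?c) (?\<alpha> - ?\<beta>) * (F \<tau> (?a - ?c) ?\<beta> * F \<tau> (?b - ?d) ?\<alpha> * F \<tau> (?a - ?d) h) +
      F \<tau> (?c - ?d) h * (F \<tau> (?a - ?d) ?\<beta> * F \<tau> (?b - ?c) ?\<alpha> * F \<tau> (?a - ?c) h)"
    by (rule exchange_identity) (use i x \<mu> in \<open>auto simp: gen_x_def gen_mu_def\<close>)
  from arg_cong[OF this, of "\<lambda>z. R x \<mu> * z"] show ?thesis
    unfolding L Rr w by (simp only: distrib_left mult.left_commute)
qed

text \<open>The rightmost letter acts directly on the minimal class, where the three-term identity
  applies. The parameters of the letters in \<open>js\<close> survive the replacement by
  \<open>signed_sw\<close>.\<close>

lemma wval_exchange:
  assumes i: "1 \<le> i" "i < n" and \<mu>: "gen_mu \<mu>" and js: "set js \<subseteq> {1..<2*n}"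
    and x: "gen_x x"
  shows "wval (js @ [n + i]) x \<mu> = wval (js @ [i]) x (\<mu> \<circ> sw i)"
  using js x
proof (induction js arbitrary: x)
  case Nil
  then show ?case
    using wval_exchange_single[OF i _ \<mu>] by (simp only: append_Nil)
next
  case (Cons k js)
  have "gen_x (x \<circ> sw k)"
    using Cons.prems by (intro gen_x_comp sw_permutes) auto
  then have IH: "wval (js @ [n + i]) x \<mu> = wval (js @ [i]) x (\<mu> \<circ> sw i)"
    "wval (js @ [n + i]) (x \<circ> sw k) \<mu> = wval (js @ [i]) (x \<circ> sw k) (\<mu> \<circ> sw i)"
    using Cons.prems by (auto intro!: Cons.IH)
  show ?case
    unfolding append_Cons wval.simps(2) IH inv_word_perm_append_single signed_sw[OF i] ..
qed

text \<open>
  Crossings of the sources are moved to the right, turned into crossings of the targets of the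
  minimal pattern, and absorbed into \<open>ks\<close>.
\<close>

lemma wval_targets_only:
  assumes "set js \<subseteq> {1..<2*n} - {n}" "set ks \<subseteq> {1..<n}"
  shows "\<exists>ls \<rho>. set ls \<subseteq> {1..<n} \<and> length ls = length js + length ks \<and> \<rho> permutes {1..n} \<and>
    (\<forall>j\<in>{1..n}. word_perm js (n + \<rho> j) = n + j \<and>
       word_perm ls j = word_perm js (word_perm ks (\<rho> j))) \<and>
    (\<forall>x \<mu>. gen_x x \<longrightarrow> gen_mu \<mu> \<longrightarrow> wval (js @ ks) x \<mu> = wval ls x (\<mu> \<circ> \<rho>))"
  using assms
\<comment> \<open>\<open>\<rho>\<close> accumulates the label exchanges and inverts the permutation
  of the sources by \<open>js\<close>. Letters leave \<open>js\<close> from its right end, and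
  \<open>ks\<close> collects target crossings, hence its generalization.\<close>
proof (induction js arbitrary: ks rule: rev_induct)
  case Nil
  then show ?case
    by (intro exI[of _ ks] exI[of _ id]) (auto simp: permutes_id simp flip: id_def)
next
  case (snoc c js)
  show ?case
  proof (cases "c < n")
    case True
    have sw: "sw c (n + j) = n + j" if "j \<ge> 1" for j
      using True that by (simp add: Transposition.transpose_def)
    obtain ls \<rho> where 1: "set ls \<subseteq> {1..<n}" "length ls = length js + length (c # ks)"
      "\<rho> permutes {1..n}"
      "\<forall>j\<in>{1..n}. word_perm js (n + \<rho> j) = n + j \<and>
       word_perm ls j = word_perm js (word_perm (c # ks) (\<rho> j))"
      "\<forall>x \<mu>. gen_x x \<longrightarrow> gen_mu \<mu> \<longrightarrow> wval (js @ c # ks) x \<mu> = wval ls x (\<mu> \<circ> \<rho>)"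
    proof -
      have "set js \<subseteq> {1..<2*n} - {n}" "set (c # ks) \<subseteq> {1..<n}"
        using snoc.prems True by auto
      from snoc.IH[OF this] show thesis
        by (elim exE conjE) (rule that)
    qed
    have "\<rho> j \<ge> 1" if "j \<in> {1..n}" for j
      using permutes_in_image[OF 1(3)] that by force
    with 1 sw show ?thesis
      by (intro exI[of _ ls] exI[of _ \<rho>])
        (auto simp: o_apply[of "word_perm js"] o_apply[of "sw c"] simp del: o_apply)
  next
    case False
    then obtain i where c: "c = n + i" and i: "1 \<le> i" "i < n"
      using snoc.prems by (intro that[of "c - n"]) auto
    obtain ls \<rho> where 1: "set ls \<subseteq> {1..<n}" "length ls = length js + length (ks @ [i])"
      "\<rho> permutes {1..n}"
      "\<forall>j\<in>{1..n}. word_perm js (n + \<rho> j) = n + j \<and>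
       word_perm ls j = word_perm js (word_perm (ks @ [i]) (\<rho> j))"
      "\<forall>x \<mu>. gen_x x \<longrightarrow> gen_mu \<mu> \<longrightarrow> wval (js @ ks @ [i]) x \<mu> = wval ls x (\<mu> \<circ> \<rho>)"
    proof -
      have "set js \<subseteq> {1..<2*n} - {n}" "set (ks @ [i]) \<subseteq> {1..<n}"
        using snoc.prems i by auto
      from snoc.IH[OF this] show thesis
        by (elim exE conjE) (rule that)
    qed
    have si: "sw i permutes {1..n}"
      using i by (intro sw_permutes) auto
    \<comment> \<open>The exchange hands \<mu> \<circ> s_i to the induction hypothesis, which
      composes it with \<open>\<rho>\<close> on the right; so s_i enters on the left of
      \<open>\<rho>\<close>.\<close>
    have \<rho>: "sw i \<circ> \<rho> permutes {1..n}"
      using 1(3) si by (rule permutes_compose)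
    have ksp: "word_perm ks permutes {1..n}"
      using snoc.prems by (intro word_perm_permutes) auto
    have sw1: "sw c p = p" if "p \<in> {1..n}" for p
      using that i c by (simp add: Transposition.transpose_def)
    have sw2: "sw c (n + sw i p) = n + p" for p
      using i c by (auto simp: Transposition.transpose_def)
    have "wval ((js @ [c]) @ ks) x \<mu> =
        wval ls x (\<mu> \<circ> (sw i \<circ> \<rho>))" if x: "gen_x x" and \<mu>: "gen_mu \<mu>" for x \<mu>
    proof -
      have "wval ((js @ [c]) @ ks) x \<mu> = wval ((js @ ks) @ [n + i]) x \<mu>"
      proof -
        have "Suc k < n + i" if "k \<in> set ks" for k
          using subsetD[OF snoc.prems(2) that] i by simp
        then have "wval (js @ (n + i) # ks) = wval (js @ ks @ [n + i])"
          by (rule wval_move)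
        then show ?thesis by (simp add: c)
      qed
      also have "\<dots> = wval ((js @ ks) @ [i]) x (\<mu> \<circ> sw i)"
        using snoc.prems by (intro wval_exchange i \<mu> x) auto
      also have "\<dots> = wval ls x ((\<mu> \<circ> sw i) \<circ> \<rho>)"
        using 1(5) x gen_mu_comp[OF \<mu> si] by simp
      finally show ?thesis by (simp add: o_assoc)
    qed
    moreover have "word_perm (js @ [c]) (n + (sw i \<circ> \<rho>) j) = n + j \<and>
        word_perm ls j = word_perm (js @ [c]) (word_perm ks ((sw i \<circ> \<rho>) j))" if j: "j \<in> {1..n}" for j
    proof -
      have "word_perm ks ((sw i \<circ> \<rho>) j) \<in> {1..n}"
        using permutes_in_image[OF ksp] permutes_in_image[OF \<rho>] j by blast
      then show ?thesis
        using 1(4) j sw1 sw2 by simp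
    qed
    ultimately show ?thesis
      using 1(1,2) \<rho> by (intro exI[of _ ls] exI[of _ "sw i \<circ> \<rho>"]) (simp del: o_apply)
  qed
qed

end

section \<open>Inversions and reduced words\<close>

definition inversions :: "(nat \<Rightarrow> nat) \<Rightarrow> (nat \<times> nat) set" where
  "inversions w = {(i, j). i < j \<and> w j < w i}"

lemma perm_length_eq_card: "perm_length w = card (inversions w)"
  by (simp add: perm_length_def inversions_def)

lemma inversions_id [simp]: "inversions id = {}"
  by (auto simp: inversions_def)

text \<open>Only the relative order of the values i and i + 1 changes, so exactly one pair of
  positions enters or leaves.\<close>

lemma inversions_sw:
  fixes i :: nat
  assumes "bij w"
  defines "p \<equiv> inv w i" and "q \<equiv> inv w (Suc i)"
  shows "p < q \<Longrightarrow> inversions (sw i \<circ> w) = insert (p, q) (inversions w) \<and> (p, q) \<notin> inversions w"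
    and "q < p \<Longrightarrow> inversions (sw i \<circ> w) = inversions w - {(q, p)} \<and> (q, p) \<in> inversions w"
    and "p \<noteq> q"
proof -
  have pq: "w p = i" "w q = Suc i"
    using assms by (simp_all add: bij_is_surj surj_f_inv_f)
  then show "p \<noteq> q" by auto
  have eq: "w a = i \<longleftrightarrow> a = p" "w a = Suc i \<longleftrightarrow> a = q" for a
    using pq assms(1) by (metis bij_is_inj injD)+
  have less: "sw i a < sw i b \<longleftrightarrow> a < b" if "\<not> (a = i \<and> b = Suc i)" "\<not> (a = Suc i \<and> b = i)" for a b
    using that by (auto simp: Transposition.transpose_def)
  have mem: "(a, b) \<in> inversions (sw i \<circ> w) \<longleftrightarrow> (a, b) \<in> inversions w"
    if "(a, b) \<noteq> (p, q)" "(a, b) \<noteq> (q, p)" for a b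
    using less[of "w b" "w a"] that by (auto simp: inversions_def eq)
  show "inversions (sw i \<circ> w) = insert (p, q) (inversions w) \<and> (p, q) \<notin> inversions w" if "p < q"
  proof -
    have "(p, q) \<in> inversions (sw i \<circ> w)" "(q, p) \<notin> inversions (sw i \<circ> w)"
      "(p, q) \<notin> inversions w" "(q, p) \<notin> inversions w"
      using that pq by (auto simp: inversions_def)
    then show ?thesis
      using mem by (auto simp: set_eq_iff) metis+
  qed
  show "inversions (sw i \<circ> w) = inversions w - {(q, p)} \<and> (q, p) \<in> inversions w" if "q < p"
  proof -
    have "(p, q) \<notin> inversions (sw i \<circ> w)" "(q, p) \<notin> inversions (sw i \<circ> w)"
      "(p, q) \<notin> inversions w" "(q, p) \<in> inversions w"
      using that pq by (auto simp: inversions_def)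
    then show ?thesis
      using mem by (auto simp: set_eq_iff) metis+
  qed
qed

text \<open>Positions range over all naturals and an infinite set has \<open>card\<close> 0, so this
  is what lets \<open>perm_length\<close> count inversions.\<close>

lemma finite_inversions_word_perm: "finite (inversions (word_perm js))"
proof (induction js)
  case (Cons i js)
  then show ?case
    using inversions_sw[where i = i and w = "word_perm js", OF bij_word_perm]
    by (metis finite.insertI finite_Diff linorder_neqE_nat word_perm_Cons)
qed (simp only: word_perm_Nil inversions_id finite.emptyI)

lemma perm_length_word_perm_Cons:
  "perm_length (word_perm (i # js)) \<le> Suc (perm_length (word_perm js))"
  using inversions_sw[where i = i and w = "word_perm js", OF bij_word_perm]
      finite_inversions_word_perm[of js]
  unfolding perm_length_eq_card word_perm_Cons
  by (metis card_Diff1_le card_insert_disjoint le_SucI linorder_neqE_nat order_refl)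

lemma inversions_word_perm_Cons:
  assumes "perm_length (word_perm js) < perm_length (word_perm (i # js))"
  shows "inversions (word_perm (i # js)) =
    insert (inv (word_perm js) i, inv (word_perm js) (Suc i)) (inversions (word_perm js))"
  using inversions_sw[where i = i and w = "word_perm js", OF bij_word_perm] assms
    finite_inversions_word_perm[of js]
  unfolding perm_length_eq_card word_perm_Cons
  by (metis card_Diff1_le linorder_neqE_nat not_le)

lemma perm_length_word_perm_le: "perm_length (word_perm js) \<le> length js"
proof (induction js)
  case Nil
  then show ?case by (simp only: word_perm_Nil perm_length_eq_card inversions_id card.empty le0)
next
  case (Cons i js)
  then show ?case
    using perm_length_word_perm_Cons[of i js] by (simp del: word_perm_Cons)
qed

text \<open>Reducedness is expressed by one inequality, the other being
  \<open>perm_length_word_perm_le\<close>. A letter raises the length by at most one, so no letter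
  of a reduced word may waste its turn.\<close>

lemma reduced_Cons:
  assumes "length (i # js) \<le> perm_length (word_perm (i # js))"
  shows "length js \<le> perm_length (word_perm js)"
    "perm_length (word_perm js) < perm_length (word_perm (i # js))"
  using assms perm_length_word_perm_Cons[of i js] perm_length_word_perm_le[of js] by simp_all

lemma word_perm_block:
  assumes "n \<notin> set js"
  shows "word_perm js k \<le> n \<longleftrightarrow> k \<le> n"
  using assms
proof (induction js)
  case (Cons i js)
  have "sw i a \<le> n \<longleftrightarrow> a \<le> n" for a
    using Cons.prems by (auto simp: Transposition.transpose_def)
  with Cons show ?case by simp
qed simp

lemma inv_word_perm_block:
  assumes "n \<notin> set js"
  shows "inv (word_perm js) k \<le> n \<longleftrightarrow> k \<le> n"
  using word_perm_block[OF assms, of "inv (word_perm js) k"]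
  by (simp add: bij_is_surj surj_f_inv_f)

text \<open>The letters acting before the first use of n keep the two blocks apart, so that use
  inverts a pair across the boundary. In a reduced word later letters only add inversions.\<close>

lemma reduced_crossing:
  assumes "length js \<le> perm_length (word_perm js)" "n \<in> set js"
  shows "\<exists>(a, b)\<in>inversions (word_perm js). a \<le> n \<and> n < b"
  using assms
proof (induction js)
  case (Cons i js)
  note red = reduced_Cons[OF Cons.prems(1)]
  show ?case
  proof (cases "n \<in> set js")
    case True
    then show ?thesis
      using Cons.IH red inversions_word_perm_Cons[OF red(2)] by (auto simp del: word_perm_Cons)
  next
    case False
    then have "inv (word_perm js) n \<le> n" "n < inv (word_perm js) (Suc n)" "i = n"
      using inv_word_perm_block[of n js] Cons.prems(2) by (auto simp flip: not_le)
    then show ?thesis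
      using inversions_word_perm_Cons[OF red(2)] by (auto simp del: word_perm_Cons)
  qed
qed simp

section \<open>Evaluation of theta polynomials\<close>

text \<open>\<open>form_val\<close>, \<open>mono_type\<close> and \<open>poly_val\<close> are all
  linear extensions of functions on generators, so additivity and substitution are proved once for
  the three of them.\<close>

definition lin :: "('a \<Rightarrow> complex) \<Rightarrow> ('a \<Rightarrow>\<^sub>0 int) \<Rightarrow> complex" where
  "lin \<phi> f = (\<Sum>k\<in>Poly_Mapping.keys f. of_int (Poly_Mapping.lookup f k) * \<phi> k)"

lemma lin_superset:
  assumes "finite A" "Poly_Mapping.keys f \<subseteq> A"
  shows "lin \<phi> f = (\<Sum>k\<in>A. of_int (Poly_Mapping.lookup f k) * \<phi> k)"
  unfolding lin_def by (rule sum.mono_neutral_left) (use assms in \<open>auto simp: in_keys_iff\<close>)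

lemma lin_add: "lin \<phi> (f + g) = lin \<phi> f + lin \<phi> g"
proof -
  let ?A = "Poly_Mapping.keys f \<union> Poly_Mapping.keys g"
  have "Poly_Mapping.keys (f + g) \<subseteq> ?A"
    by (rule Poly_Mapping.keys_add)
  then show ?thesis
    using lin_superset[of ?A f \<phi>] lin_superset[of ?A g \<phi>] lin_superset[of ?A "f + g" \<phi>]
    by (simp add: lookup_add distrib_right sum.distrib)
qed

lemma lin_0 [simp]: "lin \<phi> 0 = 0"
  by (simp add: lin_def)

lemma lin_frag_of [simp]: "lin \<phi> (frag_of k) = \<phi> k"
  by (simp add: lin_def)

lemma lin_diff: "lin \<phi> (f - g) = lin \<phi> f - lin \<phi> g"
  using lin_add[of \<phi> "f - g" g] by simp

lemma lin_sum: "lin \<phi> (\<Sum>i\<in>I. f i) = (\<Sum>i\<in>I. lin \<phi> (f i))"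
  by (induction I rule: infinite_finite_induct) (simp_all add: lin_add)

lemma lin_cong: "(\<And>k. k \<in> Poly_Mapping.keys f \<Longrightarrow> \<phi> k = \<psi> k) \<Longrightarrow> lin \<phi> f = lin \<psi> f"
  by (simp add: lin_def)

lemma lin_scale: "lin (\<lambda>k. c * \<phi> k) f = c * lin \<phi> f"
  by (simp add: lin_def sum_distrib_left mult_ac)

lemma lin_frag_extend: "lin \<phi> (frag_extend b f) = lin (\<lambda>k. lin \<phi> (b k)) f"
  by (rule frag_induction[of f UNIV]) (simp_all add: frag_extend_diff lin_diff)

lemma frag_of_mult: "frag_of a * frag_of b = (frag_of (a + b) :: 'a::monoid_add \<Rightarrow>\<^sub>0 int)"
  by (simp add: mult_single)

lemma prod_frag_of:
  "(\<Prod>i\<in>I. frag_of (f i)) = (frag_of (\<Sum>i\<in>I. f i) :: 'a::comm_monoid_add \<Rightarrow>\<^sub>0 int)"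
  by (induction I rule: infinite_finite_induct) (simp_all add: mult_single)

lemma lin_frag_of_mult:
  fixes f :: "'a::monoid_add \<Rightarrow>\<^sub>0 int"
  shows "lin \<phi> (frag_of d * f) = lin (\<lambda>m. \<phi> (d + m)) f"
  by (rule frag_induction[of f UNIV]) (simp_all add: right_diff_distrib lin_diff frag_of_mult del: Poly_Mapping.single_one)

lemma keys_frag_of_mult:
  fixes f :: "'a::monoid_add \<Rightarrow>\<^sub>0 int"
  assumes "k \<in> Poly_Mapping.keys (frag_of d * f)"
  obtains m where "m \<in> Poly_Mapping.keys f" "k = d + m"
  using assms keys_mult[of "frag_of d" f] by auto

lemma lookup_frag_extend_inj:
  assumes "inj g"
  shows "Poly_Mapping.lookup (frag_extend (\<lambda>a. frag_of (g a)) f) (g k) = Poly_Mapping.lookup f k"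
  by (rule frag_induction[of f UNIV])
    (use assms in \<open>simp_all add: frag_extend_diff lookup_minus lookup_frag_of inj_eq del: lookup_single_eq\<close>)

lemma keys_frag_extend_frag_of:
  "Poly_Mapping.keys (frag_extend (\<lambda>a. frag_of (g a)) f) \<subseteq> g ` Poly_Mapping.keys f"
  using keys_frag_extend[of "\<lambda>a. frag_of (g a)" f] by auto

lemma inj_frag_extend:
  assumes "inj g"
  shows "inj (frag_extend (\<lambda>a. frag_of (g a)))"
  by (rule injI, rule poly_mapping_eqI) (metis assms lookup_frag_extend_inj)

lemma inj_form_subst: "inj g \<Longrightarrow> inj (form_subst g)"
  unfolding form_subst_def by (rule inj_frag_extend)

lemma form_val_eq_lin: "form_val v = lin v"
  by (simp add: fun_eq_iff form_val_def lin_def)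

lemma mono_type_eq_lin: "mono_type m v = lin (\<lambda>l. (form_val v l)\<^sup>2 / 2) m"
  by (simp add: mono_type_def lin_def)

lemma poly_val_eq_lin: "poly_val \<tau> v = lin (mono_val \<tau> v)"
  by (simp add: fun_eq_iff poly_val_def lin_def)

lemma form_val_subst: "form_val v (form_subst g l) = form_val (v \<circ> g) l"
  by (simp add: form_val_eq_lin form_subst_def lin_frag_extend o_def)

lemma mono_type_subst: "mono_type (mono_subst g m) v = mono_type m (v \<circ> g)"
  by (simp add: mono_type_eq_lin mono_subst_def lin_frag_extend form_val_subst)

definition delta_mono :: "form \<Rightarrow> form \<Rightarrow> theta_mono" where
  "delta_mono a b = frag_of (a + b) - frag_of a - frag_of b"

lemma delta_eq: "delta a b = frag_of (delta_mono a b)"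
  by (simp add: delta_def delta_mono_def)

lemma mono_type_delta: "mono_type (delta_mono a b) v = form_val v a * form_val v b"
  by (simp add: delta_mono_def mono_type_eq_lin lin_diff form_val_eq_lin lin_add power2_sum field_simps)

lemma mono_type_add: "mono_type (a + b) v = mono_type a v + mono_type b v"
  by (simp add: mono_type_eq_lin lin_add)

context upper_half
begin

text \<open>
  At such \<open>v\<close> the monomial has no vanishing factor with a negative exponent, so that evaluation
  is multiplicative in spite of the junk value \<open>0 powi k = 0\<close> for \<open>k < 0\<close>.
\<close>

definition no_pole :: "(var \<Rightarrow> complex) \<Rightarrow> theta_mono \<Rightarrow> bool" where
  "no_pole v m \<longleftrightarrow> (\<forall>l. V (form_val v l) = 0 \<longrightarrow> 0 \<le> Poly_Mapping.lookup m l)"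

lemma no_pole_add: "no_pole v a \<Longrightarrow> no_pole v b \<Longrightarrow> no_pole v (a + b)"
  by (simp add: no_pole_def lookup_add)

lemma no_pole_0: "no_pole v 0"
  by (simp add: no_pole_def)

lemma no_pole_sum: "(\<And>i. i \<in> I \<Longrightarrow> no_pole v (f i)) \<Longrightarrow> no_pole v (\<Sum>i\<in>I. f i)"
  by (induction I rule: infinite_finite_induct) (simp_all add: no_pole_add no_pole_0)

lemma mono_val_superset:
  assumes "finite A" "Poly_Mapping.keys m \<subseteq> A"
  shows "mono_val \<tau> v m = (\<Prod>l\<in>A. V (form_val v l) powi Poly_Mapping.lookup m l)"
  unfolding mono_val_def by (rule prod.mono_neutral_left) (use assms in \<open>auto simp: in_keys_iff\<close>)

lemma mono_val_add:
  assumes "no_pole v a" "no_pole v b"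
  shows "mono_val \<tau> v (a + b) = mono_val \<tau> v a * mono_val \<tau> v b"
proof -
  let ?A = "Poly_Mapping.keys a \<union> Poly_Mapping.keys b"
  have "V (form_val v l) powi (Poly_Mapping.lookup (a + b) l) =
      V (form_val v l) powi (Poly_Mapping.lookup a l) * V (form_val v l) powi (Poly_Mapping.lookup b l)" for l
  proof (cases "V (form_val v l) = 0")
    case True
    then have "0 \<le> Poly_Mapping.lookup a l" "0 \<le> Poly_Mapping.lookup b l"
      using assms by (auto simp: no_pole_def)
    then show ?thesis
      unfolding True by (auto simp: lookup_add power_int_0_left_if)
  qed (simp add: lookup_add power_int_add)
  moreover have "Poly_Mapping.keys (a + b) \<subseteq> ?A"
    by (rule Poly_Mapping.keys_add)
  ultimately show ?thesis
    using mono_val_superset[of ?A "a + b" v] mono_val_superset[of ?A a v]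
        mono_val_superset[of ?A b v]
    by (simp add: prod.distrib)
qed

lemma mono_val_0 [simp]: "mono_val \<tau> v 0 = 1"
  by (simp add: mono_val_def)

lemma mono_val_sum:
  "(\<And>i. i \<in> I \<Longrightarrow> no_pole v (f i)) \<Longrightarrow> mono_val \<tau> v (\<Sum>i\<in>I. f i) = (\<Prod>i\<in>I. mono_val \<tau> v (f i))"
  by (induction I rule: infinite_finite_induct) (simp_all add: mono_val_add no_pole_sum)

text \<open>Only the two denominators must be nonzero; the numerator at a + b may vanish, and
  \<open>no_pole\<close> tolerates it.\<close>

lemma delta_no_pole:
  assumes "V (form_val v a) \<noteq> 0" "V (form_val v b) \<noteq> 0"
  shows "no_pole v (delta_mono a b)"
    and "mono_val \<tau> v (delta_mono a b) = F \<tau> (form_val v a) (form_val v b)"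
proof -
  have 1: "no_pole v (frag_of l)" for l
    by (simp add: no_pole_def lookup_frag_of del: lookup_single_eq)
  have 2: "no_pole v (- frag_of l)" if "V (form_val v l) \<noteq> 0" for l
    using that by (auto simp: no_pole_def lookup_frag_of)
  have 3: "mono_val \<tau> v (frag_of l) = V (form_val v l)" "mono_val \<tau> v (- frag_of l) =
      inverse (V (form_val v l))" for l
    by (simp_all add: mono_val_def power_int_minus)
  have e: "delta_mono a b = frag_of (a + b) + (- frag_of a + - frag_of b)"
    by (simp add: delta_mono_def)
  show "no_pole v (delta_mono a b)"
    unfolding e by (intro no_pole_add 1 2 assms)
  show "mono_val \<tau> v (delta_mono a b) = F \<tau> (form_val v a) (form_val v b)"
    unfolding e mono_val_add[OF 1 no_pole_add[OF 2[OF assms(1)] 2[OF assms(2)]]]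
      mono_val_add[OF 2[OF assms(1)] 2[OF assms(2)]] 3
    by (simp add: F_eq_vtheta form_val_eq_lin lin_add divide_inverse)
qed

text \<open>Injectivity keeps distinct forms distinct, so exponents are transported one by one. A
  merging substitution could cancel a factor against its inverse formally, while at a zero of that
  factor the product of the values is 0.\<close>

lemma mono_subst_inj:
  assumes "inj g"
  shows "mono_val \<tau> v (mono_subst g m) = mono_val \<tau> (v \<circ> g) m"
    and "no_pole (v \<circ> g) m \<Longrightarrow> no_pole v (mono_subst g m)"
proof -
  let ?f = "form_subst g"
  have inj: "inj ?f" by (rule inj_form_subst[OF assms])
  have keys: "Poly_Mapping.keys (mono_subst g m) \<subseteq> ?f ` Poly_Mapping.keys m"
    unfolding mono_subst_def by (rule keys_frag_extend_frag_of)
  have lookup: "Poly_Mapping.lookup (mono_subst g m) (?f l) = Poly_Mapping.lookup m l" for l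
    unfolding mono_subst_def by (rule lookup_frag_extend_inj[OF inj])
  have "mono_val \<tau> v (mono_subst g m) =
      (\<Prod>l\<in>?f ` Poly_Mapping.keys m. V (form_val v l) powi Poly_Mapping.lookup (mono_subst g m) l)"
    by (rule mono_val_superset) (use keys in auto)
  also have "\<dots> = (\<Prod>l\<in>Poly_Mapping.keys m. V (form_val v (?f l)) powi Poly_Mapping.lookup (mono_subst g m) (?f l))"
    by (subst prod.reindex) (use inj in \<open>auto intro: inj_on_subset\<close>)
  also have "\<dots> = mono_val \<tau> (v \<circ> g) m"
    by (simp add: lookup form_val_subst mono_val_def)
  finally show "mono_val \<tau> v (mono_subst g m) = mono_val \<tau> (v \<circ> g) m" .
  show "no_pole v (mono_subst g m)" if "no_pole (v \<circ> g) m"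
    unfolding no_pole_def
  proof (intro allI impI)
    fix l assume l: "V (form_val v l) = 0"
    show "0 \<le> Poly_Mapping.lookup (mono_subst g m) l"
    proof (cases "l \<in> Poly_Mapping.keys (mono_subst g m)")
      case True
      then obtain k where "l = ?f k" using keys by auto
      then show ?thesis
        using that l by (simp add: lookup no_pole_def form_val_subst)
    qed (simp add: in_keys_iff)
  qed
qed

lemma poly_val_subst:
  assumes "inj g"
  shows "poly_val \<tau> v (poly_subst g f) = poly_val \<tau> (v \<circ> g) f"
  unfolding poly_val_eq_lin poly_subst_def lin_frag_extend lin_frag_of mono_subst_inj(1)[OF assms]
      ..

lemma poly_val_delta_mult:
  assumes "V (form_val v a) \<noteq> 0" "V (form_val v b) \<noteq> 0" "\<And>m. m \<in> Poly_Mapping.keys f \<Longrightarrow> no_pole v m"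
  shows "poly_val \<tau> v (delta a b * f) = F \<tau> (form_val v a) (form_val v b) * poly_val \<tau> v f"
proof -
  have "poly_val \<tau> v (delta a b * f) = lin (\<lambda>m. mono_val \<tau> v (delta_mono a b + m)) f"
    by (simp only: poly_val_eq_lin delta_eq lin_frag_of_mult)
  also have "\<dots> = lin (\<lambda>m. F \<tau> (form_val v a) (form_val v b) * mono_val \<tau> v m) f"
    by (rule lin_cong) (simp add: mono_val_add delta_no_pole assms)
  finally show ?thesis
    by (simp add: lin_scale poly_val_eq_lin)
qed

end

section \<open>Types of the classes and the admissible parameter\<close>

lemma pairs_eq_Sigma: "pairs n = Sigma {1..n} (\<lambda>i. {i<..n})"
  by (auto simp: pairs_def)

text \<open>The minimal class is a product of \<open>delta\<close>s, hence a single formal monomial.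
  The nodes j > n + i of its h-factors are written n + j with i < j.\<close>

definition min_mono :: "nat \<Rightarrow> theta_mono" where
  "min_mono n =
     (\<Sum>i=1..n. delta_mono (frag_of U + frag_of (X i) - frag_of (X (n + i))) (frag_of (Mu i))) +
     (\<Sum>(i, j)\<in>pairs n. delta_mono (frag_of U + frag_of (X i) - frag_of (X (n + j))) (frag_of H))"

lemma min_class_eq: "min_class n = frag_of (min_mono n)"
proof -
  have "(\<Sum>j=n+i+1..2*n. g j) = (\<Sum>j\<in>{i<..n}. g (n + j))" for g :: "nat \<Rightarrow> theta_mono" and i
    by (rule sum.reindex_bij_witness[of _ "\<lambda>j. n + j" "\<lambda>j. j - n"]) auto
  then show ?thesis
    unfolding min_class_def delta_eq prod_frag_of frag_of_mult min_mono_def pairs_eq_Sigma sum.distrib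
    by (simp add: sum.Sigma)
qed

definition pair_sum :: "nat \<Rightarrow> (nat \<Rightarrow> complex) \<Rightarrow> complex" where
  "pair_sum n x = (\<Sum>(i, j)\<in>pairs n. x i - x (n + j))"

text \<open>All pairs except one are permuted. The exceptional pair loses x_i - x_{i+1} whether its
  target or its source is moved, which is why both blocks obey the same formula.\<close>

lemma pair_sum_sw:
  assumes "1 \<le> i" "i < 2 * n" "i \<noteq> n"
  shows "pair_sum n (x \<circ> sw i) = pair_sum n x - (x i - x (Suc i))"
proof -
  have split: "pair_sum n x = (\<Sum>(k, l)\<in>pairs n - {(a, Suc a)}. x k - x (n + l)) +
      (x a - x (n + Suc a))"
    if "1 \<le> a" "a < n" for a x
  proof -
    have "{(a, Suc a)} \<subseteq> pairs n"
      using that by (simp add: pairs_def)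
    then show ?thesis
      using sum.subset_diff[of "{(a, Suc a)}" "pairs n" "\<lambda>(i, j). x i - x (n + j)"]
      by (simp add: pair_sum_def)
  qed
  show ?thesis
  proof (cases "i < n")
    case True
    let ?P = "pairs n - {(i, Suc i)}"
    have "(\<Sum>(k, l)\<in>?P. (x \<circ> sw i) k - (x \<circ> sw i) (n + l)) =
      (\<Sum>p\<in>?P. (\<lambda>(k, l). x k - x (n + l)) (map_prod (sw i) id p))"
      by (rule sum.cong) (use assms True in \<open>auto simp: pairs_def Transposition.transpose_def\<close>)
    also have "\<dots> = (\<Sum>(k, l)\<in>?P. x k - x (n + l))"
      by (rule sum.reindex_bij_betw) (rule bij_betw_pairs[OF assms(1) True])
    finally have "(\<Sum>(k, l)\<in>?P. (x \<circ> sw i) k - (x \<circ> sw i) (n + l)) = (\<Sum>(k, l)\<in>?P. x k - x (n + l))" .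
    moreover have "(x \<circ> sw i) i = x (Suc i)" "(x \<circ> sw i) (n + Suc i) = x (n + Suc i)"
      using True assms by (simp_all add: Transposition.transpose_def)
    ultimately show ?thesis
      unfolding split[OF assms(1) True] by (simp only:) simp
  next
    case False
    define a where "a = i - n"
    have a: "i = n + a" "1 \<le> a" "a < n"
      using assms False by (auto simp: a_def)
    let ?P = "pairs n - {(a, Suc a)}"
    have "(\<Sum>(k, l)\<in>?P. (x \<circ> sw i) k - (x \<circ> sw i) (n + l)) =
      (\<Sum>p\<in>?P. (\<lambda>(k, l). x k - x (n + l)) (map_prod id (sw a) p))"
      by (rule sum.cong) (use a in \<open>auto simp: pairs_def sw_add sw_less\<close>)
    also have "\<dots> = (\<Sum>(k, l)\<in>?P. x k - x (n + l))"
      by (rule sum.reindex_bij_betw) (rule bij_betw_pairs[OF a(2,3)])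
    finally have "(\<Sum>(k, l)\<in>?P. (x \<circ> sw i) k - (x \<circ> sw i) (n + l)) = (\<Sum>(k, l)\<in>?P. x k - x (n + l))" .
    moreover have "(x \<circ> sw i) a = x a" "(x \<circ> sw i) (n + Suc a) = x i" "x (n + Suc a) = x (Suc i)"
      using a by (simp_all add: Transposition.transpose_def)
    ultimately show ?thesis
      unfolding split[OF a(2,3)] by (simp only:) simp
  qed
qed

text \<open>
  This is the type of the class of \<open>w P\<^sup>m\<^sup>i\<^sup>n\<close>: the part with \<open>h\<close> does not depend on \<open>w\<close>, because
  \<open>s\<^sub>i\<close> lowers \<open>pair_sum\<close> by \<open>x\<^sub>i - x\<^sub>i\<^sub>+\<^sub>1\<close> for every \<open>i \<noteq> n\<close>.
\<close>

definition word_type :: "nat \<Rightarrow> (nat \<Rightarrow> nat) \<Rightarrow> (var \<Rightarrow> complex) \<Rightarrow> complex" where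
  "word_type n w v =
     (\<Sum>k=1..2*n. v (X (w k)) * signed n (v \<circ> Mu) k) + v H * pair_sum n (v \<circ> X) +
     v U * ((\<Sum>i=1..n. v (Mu i)) + v H * of_nat (card (pairs n)))"

lemma form_val_simps:
  "form_val v (frag_of a) = v a"
  "form_val v (a1 + b1) = form_val v a1 + form_val v b1"
  "form_val v (a1 - b1) = form_val v a1 - form_val v b1"
  by (simp_all add: form_val_eq_lin lin_add lin_diff)

lemma mono_type_min: "mono_type (min_mono n) v = word_type n id v"
proof -
  have 1: "mono_type (\<Sum>i\<in>I. f i) v = (\<Sum>i\<in>I. mono_type (f i) v)" for f :: "'z \<Rightarrow> theta_mono" and I
    by (simp add: mono_type_eq_lin lin_sum)
  have "(\<Sum>k=1..n+n. v (X k) * signed n (v \<circ> Mu) k) =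
      (\<Sum>i=1..n. v (X i) * v (Mu i)) + (\<Sum>k=1+n..n+n. v (X k) * signed n (v \<circ> Mu) k)"
    by (subst sum.ub_add_nat) (auto simp: signed_def)
  also have "(\<Sum>k=1+n..n+n. v (X k) * signed n (v \<circ> Mu) k) = (\<Sum>i=1..n. v (X (i + n)) * (- v (Mu i)))"
    unfolding sum.shift_bounds_cl_nat_ivl by (rule sum.cong) (auto simp: signed_def)
  also have "(\<Sum>i=1..n. v (X i) * v (Mu i)) + \<dots> = (\<Sum>i=1..n. (v (X i) - v (X (n + i))) * v (Mu i))"
    by (simp add: sum.distrib[symmetric] algebra_simps)
  finally have 2: "(\<Sum>k=1..2*n. v (X k) * signed n (v \<circ> Mu) k) =
      (\<Sum>i=1..n. (v (X i) - v (X (n + i))) * v (Mu i))"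
    unfolding mult_2 .
  have 3: "(\<Sum>(i, j)\<in>pairs n. (v U + v (X i) - v (X (n + j))) * v H) =
     v H * pair_sum n (v \<circ> X) + v U * v H * of_nat (card (pairs n))"
  proof -
    have "(\<Sum>(i, j)\<in>pairs n. (v U + v (X i) - v (X (n + j))) * v H) =
      (\<Sum>p\<in>pairs n. v H * (case p of (i, j) \<Rightarrow> v (X i) - v (X (n + j))) + v U * v H)"
      by (rule sum.cong) (auto simp: algebra_simps)
    then show ?thesis
      by (simp add: sum.distrib pair_sum_def sum_distrib_left o_def)
  qed
  have A: "mono_type (\<Sum>i=1..n. delta_mono (frag_of U + frag_of (X i) - frag_of (X (n + i))) (frag_of (Mu i))) v =
      (\<Sum>i=1..n. (v (X i) - v (X (n + i))) * v (Mu i)) + v U * (\<Sum>i=1..n. v (Mu i))"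
    unfolding 1 mono_type_delta form_val_simps sum_distrib_left sum.distrib[symmetric]
    by (rule sum.cong) (auto simp: algebra_simps)
  have B: "mono_type (\<Sum>(i, j)\<in>pairs n. delta_mono (frag_of U + frag_of (X i) - frag_of (X (n + j))) (frag_of H)) v =
      (\<Sum>(i, j)\<in>pairs n. (v U + v (X i) - v (X (n + j))) * v H)"
    unfolding 1 by (rule sum.cong) (auto simp: mono_type_delta form_val_simps)
  show ?thesis
    unfolding min_mono_def mono_type_add A B 3 word_type_def id_apply 2
    by (simp add: algebra_simps)
qed

text \<open>The first identity, divided by x_i - x_{i+1}, yields the admissible parameter. In the
  second, the last term is the type of the coefficient in front of the s_i summand, so that summand
  has the type attached to s_i w.\<close>

lemma word_type_sw:
  assumes w: "w permutes {1..2*n}" and i: "1 \<le> i" "i < 2 * n" "i \<noteq> n"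
  shows "word_type n w (v \<circ> x_perm (sw i)) = word_type n w v - (v (X i) - v (X (Suc i))) *
      (signed n (v \<circ> Mu) (inv w i) - signed n (v \<circ> Mu) (inv w (Suc i)) + v H)"
    and "word_type n (sw i \<circ> w) v =
        word_type n w (v \<circ> x_perm (sw i)) + (v (X i) - v (X (Suc i))) * v H"
proof -
  let ?s = "signed n (v \<circ> Mu)" and ?v = "v \<circ> x_perm (sw i)"
  have c: "?v \<circ> Mu = v \<circ> Mu" "?v \<circ> X = (v \<circ> X) \<circ> sw i" "?v H = v H" "?v U = v U" "?v (Mu k) =
      v (Mu k)"
    "?v (X k) = v (X (sw i k))" for k
    by (auto simp: fun_eq_iff)
  note Q = pair_sum_sw[OF i, of "v \<circ> X"]
  show "word_type n (sw i \<circ> w) v = word_type n w ?v + (v (X i) - v (X (Suc i))) * v H"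
    unfolding word_type_def c Q by (simp add: algebra_simps)
  have "(\<Sum>k=1..2*n. v (X (w k)) * ?s k) - (\<Sum>k=1..2*n. v (X (sw i (w k))) * ?s k) =
     (\<Sum>k=1..2*n. (v (X (w k)) - v (X (sw i (w k)))) * ?s k)"
    by (simp add: sum_subtractf left_diff_distrib)
  \<comment> \<open>Reindexing by the node w k instead of k leaves only the nodes i and i + 1, the
    others being fixed by s_i.\<close>
  also have "\<dots> = (\<Sum>k=1..2*n. ((\<lambda>k. (v (X k) - v (X (sw i k))) * ?s (inv w k)) \<circ> w) k)"
    using permutes_inverses(2)[OF w] by simp
  also have "\<dots> = (\<Sum>k=1..2*n. (v (X k) - v (X (sw i k))) * ?s (inv w k))"
    by (rule sum.permute[OF w, symmetric])
  also have "\<dots> = (\<Sum>k\<in>{i, Suc i}. (v (X k) - v (X (sw i k))) * ?s (inv w k))"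
    by (rule sum.mono_neutral_right) (use i in \<open>auto simp: Transposition.transpose_def\<close>)
  also have "\<dots> = (v (X i) - v (X (Suc i))) * (?s (inv w i) - ?s (inv w (Suc i)))"
    by (simp add: algebra_simps)
  finally have S: "(\<Sum>k=1..2*n. v (X (sw i (w k))) * ?s k) = (\<Sum>k=1..2*n. v (X (w k)) * ?s k) -
      (v (X i) - v (X (Suc i))) * (?s (inv w i) - ?s (inv w (Suc i)))"
    by (simp add: algebra_simps)
  show "word_type n w ?v = word_type n w v - (v (X i) - v (X (Suc i))) *
      (?s (inv w i) - ?s (inv w (Suc i)) + v H)"
    unfolding word_type_def c Q S by (simp add: algebra_simps)
qed

text \<open>Admissibility speaks about the monomials that occur, so one of them is required from
  which the parameter can be read.\<close>

lemma admissible_value: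
  assumes adm: "admissible n i g \<nu>" and ne: "Poly_Mapping.keys g \<noteq> {}"
    and type: "\<And>m v. m \<in> Poly_Mapping.keys g \<Longrightarrow> mono_type m v = word_type n w v"
    and w: "w permutes {1..2*n}" and i: "1 \<le> i" "i < 2 * n" "i \<noteq> n"
  shows "form_val v \<nu> = signed n (v \<circ> Mu) (inv w i) - signed n (v \<circ> Mu) (inv w (Suc i))"
proof -
  \<comment> \<open>At x_i = 1, x_{i+1} = 0 the cleared denominator is 1, and the value of \<nu> is
    unaffected because \<nu> contains no x.\<close>
  define v' where "v' = v(X i := 1, X (Suc i) := 0)"
  have keys: "Poly_Mapping.keys \<nu> \<subseteq> insert H (Mu ` {1..n})"
    using adm by (simp add: admissible_def)
  have "form_val v \<nu> = form_val v' \<nu>"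
    unfolding form_val_def by (rule sum.cong) (use keys in \<open>auto simp: v'_def\<close>)
  moreover have c: "v' \<circ> Mu = v \<circ> Mu" "v' (X i) = 1" "v' (X (Suc i)) = 0"
    by (auto simp: v'_def fun_eq_iff)
  obtain m where m: "m \<in> Poly_Mapping.keys g"
    using ne by blast
  have "(v' (X i) - v' (X (Suc i))) * (form_val v' \<nu> + v' H) =
      mono_type m v' - mono_type m (v' \<circ> x_perm (sw i))"
    using adm m by (simp add: admissible_def)
  then have "form_val v' \<nu> = signed n (v' \<circ> Mu) (inv w i) - signed n (v' \<circ> Mu) (inv w (Suc i))"
    unfolding type[OF m] word_type_sw(1)[OF w i] c by (simp add: algebra_simps)
  ultimately show ?thesis
    by (simp only: c)
qed

lemma keys_C_op:
  assumes "k \<in> Poly_Mapping.keys (C_op i \<nu> g)"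
  obtains m where "m \<in> Poly_Mapping.keys g"
      "k = delta_mono (frag_of (X (Suc i)) - frag_of (X i)) \<nu> + m"
    | m where "m \<in> Poly_Mapping.keys g"
      "k = delta_mono (frag_of (X i) - frag_of (X (Suc i))) (frag_of H) +
          mono_subst (x_perm (sw i)) m"
proof -
  have "k \<in> Poly_Mapping.keys (delta (frag_of (X (Suc i)) - frag_of (X i)) \<nu> * g) \<or>
      k \<in> Poly_Mapping.keys (delta (frag_of (X i) - frag_of (X (Suc i))) (frag_of H) *
        poly_subst (x_perm (sw i)) g)"
    using subsetD[OF Poly_Mapping.keys_add assms[unfolded C_op_def]] unfolding Un_iff .
  moreover have keys: "Poly_Mapping.keys (poly_subst (x_perm (sw i)) g) \<subseteq> mono_subst (x_perm (sw i)) ` Poly_Mapping.keys g"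
    unfolding poly_subst_def by (rule keys_frag_extend_frag_of)
  ultimately consider "k \<in> Poly_Mapping.keys (frag_of (delta_mono (frag_of (X (Suc i)) - frag_of (X i)) \<nu>) * g)"
    | "k \<in> Poly_Mapping.keys (frag_of (delta_mono (frag_of (X i) - frag_of (X (Suc i))) (frag_of H)) *
        poly_subst (x_perm (sw i)) g)"
    unfolding delta_eq by (elim disjE)
  then show thesis
  proof cases
    case 1
    then show thesis
      by (rule keys_frag_of_mult) (rule that(1))
  next
    case 2
    then obtain m where m: "m \<in> Poly_Mapping.keys (poly_subst (x_perm (sw i)) g)"
      "k = delta_mono (frag_of (X i) - frag_of (X (Suc i))) (frag_of H) + m"
      by (rule keys_frag_of_mult)
    from keys m(1) obtain m' where "m' \<in> Poly_Mapping.keys g" "m = mono_subst (x_perm (sw i)) m'"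
      by blast
    with m(2) show thesis
      using that(2) by simp
  qed
qed

lemma inj_x_perm: "inj p \<Longrightarrow> inj (x_perm p)"
proof (rule injI)
  fix a b assume "inj p" "x_perm p a = x_perm p b"
  then show "a = b"
    by (cases a; cases b) (auto dest: injD)
qed

lemma inj_mu_perm: "inj p \<Longrightarrow> inj (mu_perm p)"
proof (rule injI)
  fix a b assume "inj p" "mu_perm p a = mu_perm p b"
  then show "a = b"
    by (cases a; cases b) (auto dest: injD)
qed

section \<open>From formal classes to their values\<close>

context elliptic
begin

definition gen_at :: "(var \<Rightarrow> complex) \<Rightarrow> bool" where
  "gen_at v \<longleftrightarrow> gen_x (v \<circ> X) \<and> gen_mu (v \<circ> Mu) \<and> v H = h \<and> v U = 0"

lemma min_mono_val:
  assumes "gen_at v"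
  shows "no_pole v (min_mono n)" "mono_val \<tau> v (min_mono n) = wval [] (v \<circ> X) (v \<circ> Mu)"
proof -
  have U: "v U = 0" "v H = h" and V: "V (v (X i) - v (X (n + j))) \<noteq> 0" "V (v (Mu i)) \<noteq> 0" "V h \<noteq> 0"
    if "i \<in> {1..n}" "j \<in> {1..n}" for i j
    using assms that by (auto simp: gen_at_def gen_x_def gen_mu_def)
  have 1: "no_pole v (delta_mono (frag_of U + frag_of (X i) - frag_of (X (n + i))) (frag_of (Mu i)))"
    "mono_val \<tau> v (delta_mono (frag_of U + frag_of (X i) - frag_of (X (n + i))) (frag_of (Mu i))) =
       F \<tau> (v (X i) - v (X (n + i))) (v (Mu i))" if "i \<in> {1..n}" for i
    using U[OF that that] V[OF that that]
      delta_no_pole[of v "frag_of U + frag_of (X i) - frag_of (X (n + i))" "frag_of (Mu i)"]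
    by (simp_all add: form_val_simps)
  have 2: "no_pole v (delta_mono (frag_of U + frag_of (X i) - frag_of (X (n + j))) (frag_of H))"
    "mono_val \<tau> v (delta_mono (frag_of U + frag_of (X i) - frag_of (X (n + j))) (frag_of H)) =
       F \<tau> (v (X i) - v (X (n + j))) h" if "(i, j) \<in> pairs n" for i j
  proof -
    have "i \<in> {1..n}" "j \<in> {1..n}"
      using that by (auto simp: pairs_def)
    from U[OF this] V[OF this] show
      "no_pole v (delta_mono (frag_of U + frag_of (X i) - frag_of (X (n + j))) (frag_of H))"
      "mono_val \<tau> v (delta_mono (frag_of U + frag_of (X i) - frag_of (X (n + j))) (frag_of H)) =
       F \<tau> (v (X i) - v (X (n + j))) h"
      using delta_no_pole[of v "frag_of U + frag_of (X i) - frag_of (X (n + j))" "frag_of H"]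
      by (simp_all add: form_val_simps)
  qed
  let ?A = "\<Sum>i=1..n. delta_mono (frag_of U + frag_of (X i) - frag_of (X (n + i))) (frag_of (Mu i))"
  let ?f = "\<lambda>(i, j). delta_mono (frag_of U + frag_of (X i) - frag_of (X (n + j))) (frag_of H)"
  have f: "no_pole v (?f p)" if "p \<in> pairs n" for p
    using 2(1) that by (cases p) auto
  have A: "no_pole v ?A" "no_pole v (\<Sum>p\<in>pairs n. ?f p)"
    using f by (auto intro!: no_pole_sum 1)
  show "no_pole v (min_mono n)"
    unfolding min_mono_def by (rule no_pole_add[OF A])
  have "mono_val \<tau> v ?A = (\<Prod>i=1..n. F \<tau> (v (X i) - v (X (n + i))) (v (Mu i)))"
    by (subst mono_val_sum) (auto intro!: prod.cong 1)
  moreover have "mono_val \<tau> v (\<Sum>p\<in>pairs n. ?f p) =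
      (\<Prod>(i, j)\<in>pairs n. F \<tau> (v (X i) - v (X (n + j))) h)"
  proof -
    have "mono_val \<tau> v (\<Sum>p\<in>pairs n. ?f p) = (\<Prod>p\<in>pairs n. mono_val \<tau> v (?f p))"
      by (rule mono_val_sum) (rule f)
    also have "\<dots> = (\<Prod>(i, j)\<in>pairs n. F \<tau> (v (X i) - v (X (n + j))) h)"
      by (rule prod.cong) (use 2(2) in auto)
    finally show ?thesis .
  qed
  ultimately show "mono_val \<tau> v (min_mono n) = wval [] (v \<circ> X) (v \<circ> Mu)"
    unfolding min_mono_def mono_val_add[OF A] by simp
qed

text \<open>The type determines the next parameter, and the absence of poles allows evaluation term
  by term. The sum of the coefficients, doubled by every \<open>C_op\<close>, certifies that the
  terms never cancel completely, so that a monomial remains to read the parameter from.\<close>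

lemma word_class_val:
  assumes "word_class n js g" "set js \<subseteq> {1..<2*n} - {n}"
  shows "(\<forall>m\<in>Poly_Mapping.keys g. \<forall>v. mono_type m v = word_type n (word_perm js) v) \<and>
    lin (\<lambda>_. 1) g \<noteq> 0 \<and>
    (\<forall>v. gen_at v \<longrightarrow> (\<forall>m\<in>Poly_Mapping.keys g. no_pole v m) \<and>
       poly_val \<tau> v g = wval js (v \<circ> X) (v \<circ> Mu))"
  using assms
proof (induction rule: word_class.induct)
  case Nil
  show ?case
    unfolding min_class_eq keys_frag_of poly_val_eq_lin lin_frag_of
    using min_mono_val mono_type_min[of n] by (auto simp only: word_perm_Nil one_neq_zero)
next
  case (Cons js g i \<nu>)
  let ?w = "word_perm js" and ?v = "\<lambda>v. v \<circ> x_perm (sw i)"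
  have i: "1 \<le> i" "i < 2 * n" "i \<noteq> n" and n: "n \<notin> set js"
    using Cons.prems by auto
  have w: "?w permutes {1..2*n}"
    using Cons.prems by (intro word_perm_permutes) auto
  have type: "\<And>m v. m \<in> Poly_Mapping.keys g \<Longrightarrow> mono_type m v = word_type n ?w v"
    and aug: "lin (\<lambda>_. 1) g \<noteq> 0"
    and val: "\<And>v. gen_at v \<Longrightarrow> poly_val \<tau> v g = wval js (v \<circ> X) (v \<circ> Mu)"
    and np: "\<And>v m. gen_at v \<Longrightarrow> m \<in> Poly_Mapping.keys g \<Longrightarrow> no_pole v m"
  proof -
    have "set js \<subseteq> {1..<2*n} - {n}"
      using Cons.prems by auto
    note IH = Cons.IH[OF this]
    show "\<And>m v. m \<in> Poly_Mapping.keys g \<Longrightarrow> mono_type m v = word_type n ?w v"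
      "lin (\<lambda>_. 1) g \<noteq> 0"
      "\<And>v. gen_at v \<Longrightarrow> poly_val \<tau> v g = wval js (v \<circ> X) (v \<circ> Mu)"
      "\<And>v m. gen_at v \<Longrightarrow> m \<in> Poly_Mapping.keys g \<Longrightarrow> no_pole v m"
      using IH by blast+
  qed
  have ne: "Poly_Mapping.keys g \<noteq> {}"
    using aug by (auto simp: lin_def)
  note \<nu> = admissible_value[OF Cons.hyps(2) ne type w i]
  have inj: "inj (x_perm (sw i))"
    by (rule inj_x_perm) simp
  have Hv: "?v v (Mu k) = v (Mu k)" "?v v \<circ> Mu = v \<circ> Mu" "?v v \<circ> X = (v \<circ> X) \<circ> sw i"
    "?v v H = v H" "?v v U = v U" for v k
    by (auto simp: fun_eq_iff)
  have gen_v: "gen_at (?v v)" if "gen_at v" for v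
    using that i gen_x_comp[of "v \<circ> X" "sw i"] sw_permutes[of i "{1..2*n}"]
    unfolding gen_at_def Hv by simp
  have T: "mono_type k v = word_type n (word_perm (i # js)) v"
    if "k \<in> Poly_Mapping.keys (C_op i \<nu> g)" for k v
    using that
  proof (cases rule: keys_C_op)
    case (1 m)
    then show ?thesis
      unfolding word_perm_Cons word_type_sw[OF w i]
      by (simp add: mono_type_add mono_type_delta \<nu> type form_val_simps algebra_simps)
  next
    case (2 m)
    then show ?thesis
      unfolding word_perm_Cons word_type_sw(2)[OF w i]
      by (simp add: mono_type_add mono_type_delta mono_type_subst type form_val_simps algebra_simps)
  qed
  have A: "lin (\<lambda>_. 1) (C_op i \<nu> g) \<noteq> 0"
    using aug unfolding C_op_def delta_eq lin_add lin_frag_of_mult poly_subst_def lin_frag_extend by simp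
  have G: "(\<forall>m\<in>Poly_Mapping.keys (C_op i \<nu> g). no_pole v m) \<and>
      poly_val \<tau> v (C_op i \<nu> g) = wval (i # js) (v \<circ> X) (v \<circ> Mu)" if v: "gen_at v" for v
  proof -
    have X: "V (v (X (Suc i)) - v (X i)) \<noteq> 0" "V (v (X i) - v (X (Suc i))) \<noteq> 0"
      using v i by (auto simp: gen_at_def gen_x_def)
    have H: "v H = h" "V h \<noteq> 0"
      using v by (auto simp: gen_at_def gen_mu_def)
    \<comment> \<open>Without the letter n both preimages lie in the same block, so the parameter is
      a difference of two distinct labels and generic \<mu> make it a regular argument.\<close>
    have N: "V (form_val v \<nu>) \<noteq> 0"
    proof -
      let ?p = "inv ?w i" and ?q = "inv ?w (Suc i)"
      have "?p \<in> {1..2*n}" "?q \<in> {1..2*n}"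
        unfolding permutes_in_image[OF permutes_inv[OF w]] using i by simp_all
      moreover have "?p \<noteq> ?q"
        using inj_eq[OF permutes_inj[OF permutes_inv[OF w]], of i "Suc i"] by simp
      ultimately have pq: "?p \<in> {1..2*n}" "?q \<in> {1..2*n}" "?p \<noteq> ?q" .
      have le: "?p \<le> n \<longleftrightarrow> i \<le> n" "?q \<le> n \<longleftrightarrow> Suc i \<le> n"
        using inv_word_perm_block[OF n] by blast+
      have \<mu>: "V (v (Mu a) - v (Mu b)) \<noteq> 0" if "a \<in> {1..n}" "b \<in> {1..n}" "a \<noteq> b" for a b
        using v that by (auto simp: gen_at_def gen_mu_def)
      show ?thesis
      proof (cases "i < n")
        case True
        then show ?thesis
          using \<mu>[of ?p ?q] pq le by (simp add: \<nu> signed_def)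
      next
        case False
        then have "\<not> ?p \<le> n" "\<not> ?q \<le> n"
          using le i by simp_all
        moreover from this have "?q - n \<in> {1..n}" "?p - n \<in> {1..n}" "?q - n \<noteq> ?p - n"
          using pq by auto
        from \<mu>[OF this] have "V (v (Mu (?q - n)) - v (Mu (?p - n))) \<noteq> 0" .
        ultimately show ?thesis
          by (simp add: \<nu> signed_def)
      qed
    qed
    note d1 = delta_no_pole[of v "frag_of (X (Suc i)) - frag_of (X i)" \<nu>]
    note d2 = delta_no_pole[of v "frag_of (X i) - frag_of (X (Suc i))" "frag_of H"]
    have "no_pole v k" if "k \<in> Poly_Mapping.keys (C_op i \<nu> g)" for k
      using that
    proof (cases rule: keys_C_op)
      case (1 m)
      then show ?thesis
        using d1 X N np[OF v] by (simp add: form_val_simps no_pole_add)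
    next
      case (2 m)
      then show ?thesis
        using d2 X H mono_subst_inj(2)[OF inj np[OF gen_v[OF v]]]
        by (simp add: form_val_simps no_pole_add)
    qed
    moreover have "poly_val \<tau> v (C_op i \<nu> g) = wval (i # js) (v \<circ> X) (v \<circ> Mu)"
    proof -
      have "no_pole v m" if "m \<in> Poly_Mapping.keys (poly_subst (x_perm (sw i)) g)" for m
      proof -
        have "m \<in> mono_subst (x_perm (sw i)) ` Poly_Mapping.keys g"
          by (rule subsetD[OF keys_frag_extend_frag_of that[unfolded poly_subst_def]])
        then show ?thesis
          using mono_subst_inj(2)[OF inj np[OF gen_v[OF v]]] by auto
      qed
      then have 2: "poly_val \<tau> v (delta (frag_of (X i) - frag_of (X (Suc i))) (frag_of H) * poly_subst (x_perm (sw i)) g) =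
         F \<tau> (v (X i) - v (X (Suc i))) h * poly_val \<tau> (?v v) g"
        using poly_val_delta_mult[of v "frag_of (X i) - frag_of (X (Suc i))" "frag_of H"] X H
        by (simp add: form_val_simps poly_val_subst[OF inj])
      have 1: "poly_val \<tau> v (delta (frag_of (X (Suc i)) - frag_of (X i)) \<nu> * g) =
         F \<tau> (v (X (Suc i)) - v (X i)) (form_val v \<nu>) * poly_val \<tau> v g"
        using poly_val_delta_mult[of v "frag_of (X (Suc i)) - frag_of (X i)" \<nu> g] X N np[OF v]
        by (simp add: form_val_simps)
      have "poly_val \<tau> v (C_op i \<nu> g) =
         poly_val \<tau> v (delta (frag_of (X (Suc i)) - frag_of (X i)) \<nu> * g) +
         poly_val \<tau> v (delta (frag_of (X i) - frag_of (X (Suc i))) (frag_of H) * poly_subst (x_perm (sw i)) g)"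
        unfolding C_op_def poly_val_eq_lin lin_add ..
      then show ?thesis
        unfolding 1 2 val[OF v] val[OF gen_v[OF v]] Hv by (simp add: \<nu>)
    qed
    ultimately show ?thesis by blast
  qed
  show ?case
    using T A G by blast
qed

end

section \<open>The limit of the reduced class\<close>

definition join :: "nat \<Rightarrow> (nat \<Rightarrow> complex) \<Rightarrow> (nat \<Rightarrow> complex) \<Rightarrow> nat \<Rightarrow> complex" where
  "join n x y k = (if k \<le> n then x k else y (k - n))"

lemma join_sw: "i < n \<Longrightarrow> join n x y \<circ> sw i = join n (x \<circ> sw i) y"
  by (auto simp: fun_eq_iff join_def Transposition.transpose_def)

lemma generic_uminus: "generic n \<tau> x \<mu> h \<Longrightarrow> 0 < Im \<tau> \<Longrightarrow> generic n \<tau> x (\<lambda>i. - \<mu> i) h"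
proof -
  assume g: "generic n \<tau> x \<mu> h" and "0 < Im \<tau>"
  then interpret upper_half \<tau> by unfold_locales
  have "- \<mu> i - - \<mu> j \<in> period_lattice \<tau> \<longleftrightarrow> \<mu> j - \<mu> i \<in> period_lattice \<tau>" for i j
    by simp
  then show ?thesis
    using g unfolding generic_def by (auto simp: period_lattice_uminus)
qed

text \<open>Functions carry the product topology, so convergence of y gives convergence of each
  coordinate.\<close>

lemma tendsto_coordinate: "((\<lambda>y::nat \<Rightarrow> complex. y i) \<longlongrightarrow> a i) (at a within S)"
proof -
  have "((\<lambda>y::nat \<Rightarrow> complex. y i) \<longlongrightarrow> a i) (at a)"
  proof -
    have "continuous_on UNIV (\<lambda>y::nat \<Rightarrow> complex. y i)"
      by (rule continuous_on_product_coordinates)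
    then show ?thesis by (simp add: continuous_on_def)
  qed
  then show ?thesis
    by (rule tendsto_mono[OF at_le, rotated]) simp
qed

lemma prod_upper_pairs:
  "(\<Prod>i=1..n. \<Prod>j\<in>{i<..n}. f i j) = (\<Prod>(i, j)\<in>pairs n. f i j)"
  by (simp add: pairs_eq_Sigma prod.Sigma)

lemma prod_lower_pairs:
  "(\<Prod>i=1..n. \<Prod>j\<in>{1..<i}. f i j) = (\<Prod>(i, j)\<in>pairs n. f j i)"
proof -
  have "(\<Prod>i=1..n. \<Prod>j\<in>{1..<i}. f i j) = (\<Prod>(i, j)\<in>Sigma {1..n} (\<lambda>i. {1..<i}). f i j)"
    by (simp add: prod.Sigma)
  also have "\<dots> = (\<Prod>(i, j)\<in>pairs n. f j i)"
    by (rule prod.reindex_bij_witness[of _ prod.swap prod.swap]) (auto simp: pairs_def)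
  finally show ?thesis .
qed

lemma permutes_excedance:
  assumes "\<sigma> permutes {1..n}" "\<sigma> \<noteq> id"
  obtains i where "(i, \<sigma> i) \<in> pairs n"
proof -
  obtain i where i: "i \<in> {1..n}" "\<not> \<sigma> i \<le> i"
    using assms permutes_natset_le by blast
  moreover have "\<sigma> i \<in> {1..n}"
    using permutes_in_image[OF assms(1)] i(1) by blast
  ultimately show thesis
    by (intro that[of i]) (auto simp: pairs_def)
qed

section \<open>Reduced classes of words and their limits\<close>

context elliptic
begin

definition norm_factor :: "(nat \<Rightarrow> complex) \<Rightarrow> complex" where
  "norm_factor y = (\<Prod>(i, j)\<in>pairs n. V (y j - y i)) * (\<Prod>(i, j)\<in>pairs n. V (y i - y j + h) / V h)"

definition rval :: "nat list \<Rightarrow> (nat \<Rightarrow> complex) \<Rightarrow> (nat \<Rightarrow> complex) \<Rightarrow> (nat \<Rightarrow> complex) \<Rightarrow> complex" where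
  "rval js x y \<mu> = (\<Prod>i=1..n. \<Prod>j=1..n. V (x i - y j)) * wval js (join n x y) \<mu> / norm_factor y"

lemma rval_Cons:
  assumes "1 \<le> i" "i < n"
  shows "rval (i # js) x y \<mu> =
     F \<tau> (x (Suc i) - x i)
       (signed n \<mu> (inv (word_perm js) i) - signed n \<mu> (inv (word_perm js) (Suc i))) * rval js x y \<mu> +
     F \<tau> (x i - x (Suc i)) h * rval js (x \<circ> sw i) y \<mu>"
proof -
  have "sw i permutes {1..n}"
    using assms by (intro sw_permutes) auto
  then have "(\<Prod>k=1..n. \<Prod>j=1..n. V (x k - y j)) = (\<Prod>k=1..n. \<Prod>j=1..n. V ((x \<circ> sw i) k - y j))"
    using prod.permute[of "sw i" "{1..n}" "\<lambda>k. \<Prod>j=1..n. V (x k - y j)"] by (simp add: o_def)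
  moreover have "join n x y i = x i" "join n x y (Suc i) = x (Suc i)"
    using assms by (simp_all add: join_def)
  ultimately show ?thesis
    unfolding rval_def wval.simps(2) join_sw[OF assms(2)]
    by (simp only: distrib_left add_divide_distrib times_divide_eq_right mult_ac)
qed

lemma prod_square_split:
  "(\<Prod>i=1..n. \<Prod>j=1..n. f i j) =
    (\<Prod>(i, j)\<in>pairs n. f j i) * (\<Prod>i=1..n. f i i) * (\<Prod>(i, j)\<in>pairs n. f i j)" for f :: "nat \<Rightarrow> nat \<Rightarrow> complex"
proof -
  have "(\<Prod>j=1..n. f i j) = (\<Prod>j\<in>{1..<i}. f i j) * f i i * (\<Prod>j\<in>{i<..n}. f i j)" if "i \<in> {1..n}" for i
  proof -
    have "{1..n} = {1..<i} \<union> ({i} \<union> {i<..n})"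
      using that by auto
    then have "(\<Prod>j=1..n. f i j) = (\<Prod>j\<in>{1..<i} \<union> ({i} \<union> {i<..n}). f i j)"
      by simp
    also have "\<dots> = (\<Prod>j\<in>{1..<i}. f i j) * (f i i * (\<Prod>j\<in>{i<..n}. f i j))"
      by (subst prod.union_disjoint) auto
    finally show ?thesis by (simp add: mult_ac)
  qed
  then have "(\<Prod>i=1..n. \<Prod>j=1..n. f i j) =
      (\<Prod>i=1..n. \<Prod>j\<in>{1..<i}. f i j) * (\<Prod>i=1..n. f i i) * (\<Prod>i=1..n. \<Prod>j\<in>{i<..n}. f i j)"
    by (simp add: prod.distrib)
  also note prod_upper_pairs
  also note prod_lower_pairs
  finally show ?thesis .
qed

lemma reduced_class_eq:
  assumes "poly_val \<tau> (assignment n x y \<mu> h) f = wval js (join n x y) \<mu>'"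
  shows "reduced_class n \<tau> f x y \<mu> h = rval js x y \<mu>'"
  unfolding reduced_class_def rval_def norm_factor_def assms prod_upper_pairs prod_lower_pairs ..

lemma generic_vtheta:
  assumes "generic n \<tau> x \<mu> h"
  shows "V h \<noteq> 0" "\<And>i. i \<in> {1..n} \<Longrightarrow> V (\<mu> i) \<noteq> 0"
    "\<And>i j. i \<in> {1..n} \<Longrightarrow> j \<in> {1..n} \<Longrightarrow> i \<noteq> j \<Longrightarrow>
       V (x i - x j) \<noteq> 0 \<and> V (x i - x j + h) \<noteq> 0 \<and> V (\<mu> i - \<mu> j) \<noteq> 0"
  using assms unfolding generic_def vtheta_eq_0_iff by blast+

lemma generic_gen_mu: "generic n \<tau> x \<mu> h \<Longrightarrow> gen_mu \<mu>"
  unfolding gen_mu_def using generic_vtheta by blast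

lemma generic_gen_x:
  assumes g: "generic n \<tau> x \<mu> h" and y: "y \<in> regular_points n \<tau> x h"
  shows "gen_x (join n x y)"
  unfolding gen_x_def
proof (intro ballI impI)
  fix i j assume ij: "i \<in> {1..2*n}" "j \<in> {1..2*n}" "i \<noteq> j"
  have Y: "V (x a - y b) \<noteq> 0" "a \<noteq> b \<Longrightarrow> V (y a - y b) \<noteq> 0" if "a \<in> {1..n}" "b \<in> {1..n}" for a b
    using y that unfolding regular_points_def vtheta_eq_0_iff by blast+
  have Y': "V (y b - x a) \<noteq> 0" if "a \<in> {1..n}" "b \<in> {1..n}" for a b
    using Y(1)[OF that] vtheta_minus[of "x a - y b"] by simp
  have shift: "k - n \<in> {1..n}" if "k \<in> {1..2*n}" "\<not> k \<le> n" for k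
    using that by auto
  consider "i \<le> n" "j \<le> n" | "i \<le> n" "\<not> j \<le> n" | "\<not> i \<le> n" "j \<le> n" | "\<not> i \<le> n" "\<not> j \<le> n"
    by blast
  then show "V (join n x y i - join n x y j) \<noteq> 0"
  proof cases
    case 1
    then show ?thesis
      using ij generic_vtheta(3)[OF g, of i j] by (simp add: join_def)
  next
    case 2
    then show ?thesis
      using ij Y(1)[OF _ shift[of j], of i] by (simp add: join_def)
  next
    case 3
    then show ?thesis
      using ij Y'[OF _ shift[of i], of j] by (simp add: join_def)
  next
    case 4
    then have "i - n \<noteq> j - n"
      using ij(3) by simp
    then show ?thesis
      using 4 Y(2)[OF shift[OF ij(1) 4(1)] shift[OF ij(2) 4(2)]] by (simp add: join_def)
  qed
qed

text \<open>The diagonal factors of the numerator cancel the poles of the \<mu>-factors, and those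
  with i < j cancel the poles of the h-factors. The factors below the diagonal survive, and no
  denominator mixing x and y is left.\<close>

lemma rval_Nil:
  assumes g: "generic n \<tau> x \<mu> h" and y: "y \<in> regular_points n \<tau> x h"
  shows "rval [] x y \<mu> = (\<Prod>(i, j)\<in>pairs n. V (x j - y i)) *
      (\<Prod>i=1..n. V (x i - y i + \<mu> i) / V (\<mu> i)) *
     (\<Prod>(i, j)\<in>pairs n. V (x i - y j + h) / V h) / norm_factor y"
proof -
  have Y: "V (x a - y b) \<noteq> 0" if "a \<in> {1..n}" "b \<in> {1..n}" for a b
    using y that unfolding regular_points_def vtheta_eq_0_iff by blast
  have w: "wval [] (join n x y) \<mu> =
      (\<Prod>i=1..n. F \<tau> (x i - y i) (\<mu> i)) * (\<Prod>(i, j)\<in>pairs n. F \<tau> (x i - y j) h)"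
    unfolding wval.simps
    by (intro arg_cong2[of _ _ _ _ "(*)"] prod.cong) (auto simp: join_def pairs_def)
  have 1: "(\<Prod>i=1..n. V (x i - y i)) * (\<Prod>i=1..n. F \<tau> (x i - y i) (\<mu> i)) =
      (\<Prod>i=1..n. V (x i - y i + \<mu> i) / V (\<mu> i))"
    unfolding prod.distrib[symmetric] by (rule prod.cong) (auto simp: F_eq_vtheta Y)
  have 2: "(\<Prod>(i, j)\<in>pairs n. V (x i - y j)) * (\<Prod>(i, j)\<in>pairs n. F \<tau> (x i - y j) h) =
      (\<Prod>(i, j)\<in>pairs n. V (x i - y j + h) / V h)"
    unfolding prod.distrib[symmetric] by (rule prod.cong) (auto simp: F_eq_vtheta Y pairs_def)
  show ?thesis
    unfolding rval_def w prod_square_split 1[symmetric] 2[symmetric] by (simp only: mult_ac)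
qed

lemma norm_factor_nonzero:
  assumes g: "generic n \<tau> x \<mu> h" and \<sigma>: "\<sigma> permutes {1..n}"
  shows "norm_factor (x \<circ> \<sigma>) \<noteq> 0"
proof -
  have "V ((x \<circ> \<sigma>) j - (x \<circ> \<sigma>) i) \<noteq> 0 \<and> V ((x \<circ> \<sigma>) i - (x \<circ> \<sigma>) j + h) / V h \<noteq> 0"
    if "(i, j) \<in> pairs n" for i j
  proof -
    have "i \<in> {1..n}" "j \<in> {1..n}" "i \<noteq> j"
      using that by (auto simp: pairs_def)
    then have "\<sigma> i \<in> {1..n}" "\<sigma> j \<in> {1..n}" "\<sigma> i \<noteq> \<sigma> j"
      using permutes_in_image[OF \<sigma>] inj_eq[OF permutes_inj[OF \<sigma>]] by blast+
    then show ?thesis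
      using generic_vtheta[OF g] by auto
  qed
  then show ?thesis
    unfolding norm_factor_def by (auto simp: prod_zero_iff)
qed

lemma rval_Nil_tendsto:
  assumes g: "generic n \<tau> x \<mu> h" and \<sigma>: "\<sigma> permutes {1..n}"
  shows "((\<lambda>y. rval [] x y \<mu>) \<longlongrightarrow> (if \<sigma> = id then 1 else 0)) (at (x \<circ> \<sigma>) within regular_points n \<tau> x h)"
proof -
  let ?F = "at (x \<circ> \<sigma>) within regular_points n \<tau> x h"
  define B where "B y = (\<Prod>(i, j)\<in>pairs n. V (x j - y i)) *
      (\<Prod>i=1..n. V (x i - y i + \<mu> i) / V (\<mu> i)) *
     (\<Prod>(i, j)\<in>pairs n. V (x i - y j + h) / V h) / norm_factor y" for y
  have "(B \<longlongrightarrow> B (x \<circ> \<sigma>)) ?F"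
    unfolding B_def norm_factor_def case_prod_beta'
    using norm_factor_nonzero[OF g \<sigma>] generic_vtheta[OF g]
    by (intro tendsto_intros tendsto_coordinate) (simp_all add: norm_factor_def case_prod_beta')
  moreover have "B (x \<circ> \<sigma>) = (if \<sigma> = id then 1 else 0)"
  proof (cases "\<sigma> = id")
    \<comment> \<open>At y = x the surviving factors are exactly \<open>norm_factor x\<close>; this
      is where the denominator of the reduced class comes from.\<close>
    case True
    have "(\<Prod>i=1..n. V (\<mu> i) / V (\<mu> i)) = 1"
      using generic_vtheta(2)[OF g] by (intro prod.neutral) auto
    then show ?thesis
      using norm_factor_nonzero[OF g \<sigma>] unfolding True B_def norm_factor_def by simp
  next
    case False
    then obtain i where i: "(i, \<sigma> i) \<in> pairs n"
      using permutes_excedance[OF \<sigma>] by blast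
    have "(\<Prod>(i, j)\<in>pairs n. V (x j - (x \<circ> \<sigma>) i)) = 0"
      by (rule prod_zero[OF finite_pairs]) (use i in \<open>auto intro!: bexI[of _ "(i, \<sigma> i)"]\<close>)
    then show ?thesis
      using False by (simp add: B_def)
  qed
  moreover have "eventually (\<lambda>y. rval [] x y \<mu> = B y) ?F"
    using rval_Nil[OF g] by (auto simp: eventually_at_filter B_def)
  ultimately show ?thesis
    using tendsto_cong by fastforce
qed

text \<open>Both sides satisfy the same linear recursion with coefficients constant in y, so limits
  pass through it letter by letter. Reducedness supplies the increase of length that the Schubert
  recursion requires.\<close>

lemma rval_tendsto:
  assumes E: "schubert_elliptic_classes n \<tau> E"
    and "set js \<subseteq> {1..<n}" "length js \<le> perm_length (word_perm js)"
    and "generic n \<tau> x \<mu> h" "\<sigma> permutes {1..n}"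
  shows "((\<lambda>y. rval js x y (\<lambda>i. - \<mu> i)) \<longlongrightarrow> E (word_perm js) \<sigma> x \<mu> h)
    (at (x \<circ> \<sigma>) within regular_points n \<tau> x h)"
  using assms(2-)
proof (induction js arbitrary: x \<sigma>)
  case Nil
  have e: "E id \<sigma> x \<mu> h = (if \<sigma> = id then 1 else 0)"
    using E Nil unfolding schubert_elliptic_classes_def by blast
  show ?case
    unfolding word_perm_Nil e by (rule rval_Nil_tendsto[OF generic_uminus[OF Nil(3) Im_tau] Nil(4)])
next
  case (Cons i js)
  let ?w = "word_perm js"
  have i: "1 \<le> i" "i < n" and js: "set js \<subseteq> {1..<n}"
    using Cons.prems by auto
  note red = reduced_Cons[OF Cons.prems(2)]
  have w: "?w permutes {1..n}"
    using js by (intro word_perm_permutes) auto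
  have si: "sw i permutes {1..n}"
    using i by (intro sw_permutes) auto
  \<comment> \<open>The s_i summand has x replaced by x \<circ> s_i, but its limit point, taken for
    the fixed point s_i \<sigma>, is the same; \<open>reg\<close> shows that the set of approach is
    the same too.\<close>
  have xs: "x \<circ> sw i \<circ> (sw i \<circ> \<sigma>) = x \<circ> \<sigma>"
    by (simp add: fun_eq_iff)
  have gen: "generic n \<tau> (x \<circ> sw i) \<mu> h"
  proof -
    have "sw i k \<in> {1..n}" "k \<noteq> l \<longleftrightarrow> sw i k \<noteq> sw i l" if "k \<in> {1..n}" for k l
      using permutes_in_image[OF si] that by (auto simp: inj_eq[OF permutes_inj[OF si]])
    then show ?thesis
      using Cons.prems(3) unfolding generic_def o_apply by blast
  qed
  have reg: "regular_points n \<tau> (x \<circ> sw i) h = regular_points n \<tau> x h"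
  proof -
    have "regular_points n \<tau> z h =
        {y. (\<forall>a\<in>z ` {1..n}. \<forall>j\<in>{1..n}. a - y j \<notin> period_lattice \<tau>) \<and>
           (\<forall>i\<in>{1..n}. \<forall>j\<in>{1..n}. i \<noteq> j \<longrightarrow> y i - y j \<notin> period_lattice \<tau> \<and> y i - y j + h \<notin> period_lattice \<tau>)}"
      for z
      unfolding regular_points_def ball_simps(9) by blast
    moreover have "(x \<circ> sw i) ` {1..n} = x ` {1..n}"
      unfolding image_comp[symmetric] permutes_image[OF si] ..
    ultimately show ?thesis by (simp only:)
  qed
  have "sw i \<circ> \<sigma> permutes {1..n}"
    using Cons.prems(4) si by (rule permutes_compose)
  from Cons.IH[OF js red(1) gen this]
  have 2: "((\<lambda>y. rval js (x \<circ> sw i) y (\<lambda>i. - \<mu> i)) \<longlongrightarrow> E ?w (sw i \<circ> \<sigma>) (x \<circ> sw i) \<mu> h)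
      (at (x \<circ> \<sigma>) within regular_points n \<tau> x h)"
    unfolding reg xs .
  have 1: "((\<lambda>y. rval js x y (\<lambda>i. - \<mu> i)) \<longlongrightarrow> E ?w \<sigma> x \<mu> h)
      (at (x \<circ> \<sigma>) within regular_points n \<tau> x h)"
    using Cons.IH[OF js red(1) Cons.prems(3,4)] .
  have "inv ?w i \<in> {1..n}" "inv ?w (Suc i) \<in> {1..n}"
    unfolding permutes_in_image[OF permutes_inv[OF w]] using i by simp_all
  \<comment> \<open>Here the substitution of -\<mu> for \<mu> reverses the difference of labels into
    the one of the R-matrix recursion.\<close>
  then have sg: "signed n (\<lambda>i. - \<mu> i) (inv ?w i) - signed n (\<lambda>i. - \<mu> i) (inv ?w (Suc i)) =
      \<mu> (inv ?w (Suc i)) - \<mu> (inv ?w i)"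
    by (simp add: signed_def)
  have "E (word_perm (i # js)) \<sigma> x \<mu> h =
      F \<tau> (x (Suc i) - x i) (\<mu> (inv ?w (Suc i)) - \<mu> (inv ?w i)) * E ?w \<sigma> x \<mu> h +
      F \<tau> (x i - x (Suc i)) h * E ?w (sw i \<circ> \<sigma>) (x \<circ> sw i) \<mu> h"
    using E w i red(2) Cons.prems(3,4) unfolding schubert_elliptic_classes_def word_perm_Cons by blast
  then show ?case
    unfolding rval_Cons[OF i] sg by (simp only:) (intro tendsto_intros 1 2)
qed

end

section \<open>The permutation of a pattern and the comparison of classes\<close>

lemma target_perm_permutes:
  assumes "labelled_link_pattern n P" "\<forall>i\<in>{1..n}. snd (P i) \<le> n" "\<forall>j\<in>{1..n}. fst (P j) = n + j"
  shows "target_perm n P permutes {1..n}" "j \<in> {1..n} \<Longrightarrow> P j = (n + j, target_perm n P j)"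
proof -
  have P: "P j = (n + j, target_perm n P j)" if j: "j \<in> {1..n}" for j
  proof -
    have "(THE b. \<exists>i\<in>{1..n}. P i = (n + j, b)) = snd (P j)"
    proof (rule the_equality)
      show "\<exists>i\<in>{1..n}. P i = (n + j, snd (P j))"
        using j assms(3) by (metis prod.collapse)
      fix b assume "\<exists>i\<in>{1..n}. P i = (n + j, b)"
      then obtain i where "i \<in> {1..n}" "P i = (n + j, b)" by blast
      moreover from this have "i = j"
        using assms(3) by (metis add_left_cancel fst_conv)
      ultimately show "b = snd (P j)" by simp
    qed
    then show ?thesis
      using j assms(3) by (simp add: target_perm_def prod_eq_iff)
  qed
  then show "j \<in> {1..n} \<Longrightarrow> P j = (n + j, target_perm n P j)" .
  have "target_perm n P ` {1..n} \<subseteq> {1..n}"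
  proof (rule image_subsetI)
    fix j assume j: "j \<in> {1..n}"
    have "snd (P j) = target_perm n P j"
      by (subst P[OF j]) simp
    moreover have "snd (P j) \<in> {1..2*n}" "snd (P j) \<le> n"
      using assms(1,2) j unfolding labelled_link_pattern_def by blast+
    ultimately show "target_perm n P j \<in> {1..n}" by simp
  qed
  moreover have "inj_on (target_perm n P) {1..n}"
  proof -
    have "inj_on (\<lambda>j. snd (P j)) {1..n}"
      using assms(1) unfolding labelled_link_pattern_def by blast
    also have "?this \<longleftrightarrow> ?thesis"
      by (rule inj_on_cong) (subst P, simp_all)
    finally show ?thesis .
  qed
  ultimately have "bij_betw (target_perm n P) {1..n} {1..n}"
    using endo_inj_surj[of "{1..n}" "target_perm n P"] by (simp add: bij_betw_def)
  then show "target_perm n P permutes {1..n}"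
    by (rule bij_imp_permutes) (unfold target_perm_def, rule if_not_P)
qed

theorem theorem18p2:
  fixes n :: nat and \<tau> h :: complex and P :: link_pattern and f :: theta_poly
    and E :: "(nat \<Rightarrow> nat) \<Rightarrow> (nat \<Rightarrow> nat) \<Rightarrow> (nat \<Rightarrow> complex) \<Rightarrow> (nat \<Rightarrow> complex) \<Rightarrow> complex \<Rightarrow> complex"
    and \<sigma> :: "nat \<Rightarrow> nat" and x \<mu> :: "nat \<Rightarrow> complex"
  assumes "Im \<tau> > 0"
    and "labelled_link_pattern n P"
    and "\<forall>i\<in>{1..n}. snd (P i) \<le> n"
    and "\<forall>j\<in>{1..n}. fst (P j) = n + j"
    and "link_class n P f"
    and "schubert_elliptic_classes n \<tau> E"
    and "\<sigma> permutes {1..n}"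
    and "generic n \<tau> x \<mu> h"
  shows "((\<lambda>y. reduced_class n \<tau> f x y (\<lambda>i. - \<mu> i) h) \<longlongrightarrow> E (target_perm n P) \<sigma> x \<mu> h)
           (at (x \<circ> \<sigma>) within regular_points n \<tau> x h)"
proof -
  interpret elliptic \<tau> h n
    by unfold_locales fact
  let ?b = "target_perm n P"
  note b = target_perm_permutes[OF assms(2-4)]
  obtain \<sigma>\<^sub>0 w js g where pres: "presents n \<sigma>\<^sub>0 w P"
    and min: "\<And>\<sigma>' w'. presents n \<sigma>' w' P \<Longrightarrow> perm_length w \<le> perm_length w'"
    and red: "reduced_word (2*n) w js" and wc: "word_class n js g" and f: "f =
        poly_subst (mu_perm \<sigma>\<^sub>0) g"
    using assms(5) unfolding link_class_def by blast
  have \<sigma>0: "\<sigma>\<^sub>0 permutes {1..n}" and w: "w permutes {1..2*n}"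
    using pres by (auto simp: presents_def)
  have js: "set js \<subseteq> {1..<2*n}" "word_perm js = w" "length js = perm_length w"
    using red by (auto simp: reduced_word_def)
  have wP: "w (n + i) = n + \<sigma>\<^sub>0 i \<and> w i = ?b (\<sigma>\<^sub>0 i)" if "i \<in> {1..n}" for i
  proof -
    have "\<sigma>\<^sub>0 i \<in> {1..n}"
      using permutes_in_image[OF \<sigma>0] that by blast
    moreover have "P (\<sigma>\<^sub>0 i) = (w (n + i), w i)"
      using pres that by (simp add: presents_def min_pattern_def)
    ultimately show ?thesis
      using b(2)[of "\<sigma>\<^sub>0 i"] by simp
  qed
  have wn: "w i \<in> {1..n}" if "i \<in> {1..n}" for i
    using wP[OF that] that permutes_in_image[OF \<sigma>0] permutes_in_image[OF b(1)] by metis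
  \<comment> \<open>By \<open>wP\<close> the permutation \<open>w\<close> preserves both blocks, so
    it has no inversion across their boundary, and \<open>reduced_crossing\<close> forbids the
    letter n.\<close>
  have "n \<notin> set js"
  proof
    assume "n \<in> set js"
    then obtain p q where pq: "p < q" "w q < w p" "p \<le> n" "n < q"
      using reduced_crossing[of js n] js(2,3) by (auto simp: inversions_def)
    \<comment> \<open>Nodes are numbered from 1, so position 0 is a separate case, fixed by
      \<open>w\<close>.\<close>
    have "w p \<le> n"
      using wn[of p] pq w by (cases "p = 0") (auto simp: permutes_def)
    moreover have "n < w q"
    proof (cases "q \<le> 2 * n")
      case True
      then have "q - n \<in> {1..n}" "n + (q - n) = q"
        using pq by auto
      moreover have "\<sigma>\<^sub>0 (q - n) \<in> {1..n}"
        using permutes_in_image[OF \<sigma>0] \<open>q - n \<in> {1..n}\<close> by blast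
      ultimately show ?thesis
        using wP[of "q - n"] by simp
    next
      case False
      then have "w q = q"
        using w by (auto simp: permutes_def)
      then show ?thesis using pq by simp
    qed
    ultimately show False using pq by simp
  qed
  with js(1) have js': "set js \<subseteq> {1..<2*n} - {n}" by auto
  obtain ls \<rho> where ls: "set ls \<subseteq> {1..<n}" "length ls = length js" and \<rho>: "\<rho> permutes {1..n}"
    and word: "\<And>j. j \<in> {1..n} \<Longrightarrow> w (n + \<rho> j) = n + j \<and> word_perm ls j = w (\<rho> j)"
    and val: "\<And>x \<mu>. gen_x x \<Longrightarrow> gen_mu \<mu> \<Longrightarrow> wval js x \<mu> = wval ls x (\<mu> \<circ> \<rho>)"
    using wval_targets_only[OF js', of "[]"] js(2) by auto
  have \<rho>in: "\<rho> j \<in> {1..n}" if "j \<in> {1..n}" for j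
    using permutes_in_image[OF \<rho>] that by blast
  \<comment> \<open>The label exchanges collected in \<open>\<rho>\<close> thus cancel the
    relabelling built into \<open>link_class\<close>, and the arrow with source n + j regains the
    label j.\<close>
  have \<sigma>\<rho>: "\<sigma>\<^sub>0 (\<rho> j) = j" for j
  proof (cases "j \<in> {1..n}")
    case True
    then show ?thesis
      using wP[OF \<rho>in[OF True]] word[OF True] by simp
  next
    case False
    then show ?thesis
      using permutes_not_in[OF \<rho>] permutes_not_in[OF \<sigma>0] by simp
  qed
  have lsp: "word_perm ls permutes {1..n}"
    using ls(1) by (intro word_perm_permutes) auto
  have lsb: "word_perm ls = ?b"
  proof
    fix j
    show "word_perm ls j = ?b j"
    proof (cases "j \<in> {1..n}")
      case True
      then show ?thesis
        using wP[OF \<rho>in[OF True]] word[OF True] \<sigma>\<rho> by simp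
    next
      case False
      then show ?thesis
        using permutes_not_in[OF lsp] permutes_not_in[OF b(1)] by simp
    qed
  qed
  \<comment> \<open>This competing presentation bounds the length of \<open>w\<close>, which is also
    the length of \<open>ls\<close>, by that of \<open>?b\<close>; hence \<open>ls\<close> is
    reduced.\<close>
  have "presents n id ?b P"
    unfolding presents_def
  proof (intro conjI ballI)
    show "?b permutes {1..2*n}"
      using b(1) by (rule permutes_subset) auto
    show "P (id i) = map_prod ?b ?b (min_pattern n i)" if "i \<in> {1..n}" for i
      using b(2)[OF that] that permutes_not_in[OF b(1), of "n + i"] by (simp add: min_pattern_def)
  qed (rule permutes_id)
  from min[OF this] have reduced: "length ls \<le> perm_length (word_perm ls)"
    using ls(2) js(3) lsb by simp
  let ?\<mu> = "\<lambda>i. - \<mu> i"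
  have \<mu>: "gen_mu ?\<mu>"
    by (rule generic_gen_mu[OF generic_uminus[OF assms(8,1)]])
  \<comment> \<open>At regular y no denominator vanishes, so formal evaluation is valid; the limit
    is taken along exactly these points.\<close>
  have eq: "reduced_class n \<tau> f x y ?\<mu> h = rval ls x y ?\<mu>" if y: "y \<in> regular_points n \<tau> x h" for y
  proof (rule reduced_class_eq)
    let ?v = "assignment n x y ?\<mu> h \<circ> mu_perm \<sigma>\<^sub>0"
    have v: "?v \<circ> X = join n x y" "?v \<circ> Mu = ?\<mu> \<circ> \<sigma>\<^sub>0" "?v H = h" "?v U = 0"
      by (auto simp: fun_eq_iff join_def)
    have gx: "gen_x (join n x y)"
      by (rule generic_gen_x[OF assms(8) y])
    have g\<mu>: "gen_mu (?\<mu> \<circ> \<sigma>\<^sub>0)"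
      by (rule gen_mu_comp[OF \<mu> \<sigma>0])
    have "poly_val \<tau> (assignment n x y ?\<mu> h) f = poly_val \<tau> ?v g"
      unfolding f by (rule poly_val_subst[OF inj_mu_perm[OF permutes_inj[OF \<sigma>0]]])
    also have "\<dots> = wval js (join n x y) (?\<mu> \<circ> \<sigma>\<^sub>0)"
      using word_class_val[OF wc js'] gx g\<mu> v unfolding gen_at_def by metis
    also have "\<dots> = wval ls (join n x y) ((?\<mu> \<circ> \<sigma>\<^sub>0) \<circ> \<rho>)"
      by (rule val[OF gx g\<mu>])
    also have "(?\<mu> \<circ> \<sigma>\<^sub>0) \<circ> \<rho> = ?\<mu>"
      by (simp add: fun_eq_iff \<sigma>\<rho>)
    finally show "poly_val \<tau> (assignment n x y ?\<mu> h) f = wval ls (join n x y) ?\<mu>" .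
  qed
  have "((\<lambda>y. rval ls x y ?\<mu>) \<longlongrightarrow> E ?b \<sigma> x \<mu> h) (at (x \<circ> \<sigma>) within regular_points n \<tau> x h)"
    using rval_tendsto[OF assms(6) ls(1) reduced assms(8,7)] unfolding lsb .
  moreover have "eventually (\<lambda>y. reduced_class n \<tau> f x y ?\<mu> h = rval ls x y ?\<mu>)
      (at (x \<circ> \<sigma>) within regular_points n \<tau> x h)"
    using eq by (auto simp: eventually_at_filter)
  ultimately show ?thesis
    by (simp add: tendsto_cong)
qed

end
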